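(* Let $G$ be a transitive digraph and $f$ a discrete Morse function on $G$. Then for each $n\ge 0$, $$\lim_{t\to\infty}W_n(t)=\mathrm{Crit}_n(G).$$
   Context: A digraph $G$ consists of a finite vertex set $V$ and a non-empty edge set $E\subseteq V\times V\setminus\mathrm{diag}$; $(u,v)\in E$ is written $u\to v$. $G$ is transitive if for any two edges $u\to v$ and $v\to w$ of $G$ there is an edge $u\to w$ of $G$. $\Lambda_n(V)$ is the real vector space with basis all sequences $v_0\cdots v_n$ of vertices (elementary $n$-paths), with the inner product $\langle\cdot,\cdot\rangle$ making elementary paths orthonormal. $\partial=\partial_n:\Lambda_n(V)\to\Lambda_{n-1}(V)$ is $\partial_n(v_0\cdots v_n)=\sum_{i=0}^n(-1)^i v_0\cdots\widehat{v_i}\cdots v_n$ (with $\partial_0=0$). An allowed elementary $n$-path on $G$ is $v_0\cdots v_n$ with $v_{i-1}\to v_i$ an edge for $1\le i\le n$; $P_n(G)\subseteq\Lambda_n(V)$ is the span of these, and $\Omega_n(G)=\{x\in P_n(G):\partial x\in P_{n-1}(G)\}$. For transitive $G$, $\Omega_n(G)=P_n(G)$ for all $n$. For allowed elementary paths, $\alpha>\beta$ (or $\beta<\alpha$) means $\beta$ is obtained from $\alpha$ by removing some vertices; a superscript $(n)$ indicates an $n$-path. For $f:V\to[0,+\infty)$ put $f(v_0\cdots v_n)=\sum_i f(v_i)$. $f$ is a discrete Morse function on $G$ if for every allowed elementary $\alpha^{(n)}$, $\#\{\gamma^{(n+1)}>\alpha \mid f(\gamma)=f(\alpha)\}\le1$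 and $\#\{\beta^{(n-1)}<\alpha \mid f(\beta)=f(\alpha)\}\le1$. An allowed elementary path $\alpha^{(n)}$ is critical if both these numbers are $0$. $\mathrm{Crit}_n(G)$ is the span of all critical $n$-paths on $G$. For $t\in\mathbb{R}$, $e^{tf}:\Omega_n(G)\to\Omega_n(G)$ is the linear map with $e^{tf}(\alpha)=e^{tf(\alpha)}\alpha$ for allowed elementary $\alpha$, and $\partial_t=e^{tf}\,\partial\, e^{-tf}$ on $\Omega_*(G)$. Let $\partial_t^*$ be the adjoint of $\partial_t$ with respect to $\langle\cdot,\cdot\rangle$, and $\Delta_n(t)=\partial_t\partial_t^*+\partial_t^*\partial_t$ on $\Omega_n(G)$. $W_n(t)$ is the span of the eigenvectors of $\Delta_n(t)$ corresponding to the eigenvalues which tend to $0$ as $t\to\infty$. The limit is a limit of linear subspaces of the finite-dimensional space $\Omega_n(G)$ (convergence in the Grassmannian, i.e. convergence of the orthogonal projections). *)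

theory Defs
  imports "HOL-Analysis.Analysis" "HOL-Analysis.Finite_Function_Topology" "HOL-Library.Sublist" "Graph_Theory.Pair_Digraph"
begin

text \<open>
  An elementary \<open>n\<close>-path is a list of \<open>n + 1\<close> vertices, and \<open>'v list \<Rightarrow>\<^sub>0 real\<close> serves as the
  direct sum of all the spaces \<open>\<Lambda>\<^sub>n\<close>, the basis vector of \<open>xs\<close> being
  \<open>Poly_Mapping.single xs 1\<close>. The empty list is not a path: there are no paths of degree \<open>-1\<close>.
  Digraphs are those of \<open>Graph_Theory.Pair_Digraph\<close>: \<open>pair_digraph G\<close> says that the vertex set is
  finite and that the arcs form a set of ordered pairs of distinct vertices.
\<close>

type_synonym 'v chain = "'v list \<Rightarrow>\<^sub>0 real"

abbreviation elem :: "'v list \<Rightarrow> 'v chain" where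
  "elem xs \<equiv> Poly_Mapping.single xs 1"

definition lin_ext :: "('v list \<Rightarrow> 'v chain) \<Rightarrow> 'v chain \<Rightarrow> 'v chain" where
  "lin_ext T x = (\<Sum>xs \<in> Poly_Mapping.keys x. Poly_Mapping.lookup x xs *\<^sub>R T xs)"

definition path_inner :: "'v chain \<Rightarrow> 'v chain \<Rightarrow> real" where
  "path_inner x y =
     (\<Sum>xs \<in> Poly_Mapping.keys x. Poly_Mapping.lookup x xs * Poly_Mapping.lookup y xs)"

text \<open>The norm of \<open>path_inner\<close>; the library's \<open>norm\<close> on \<open>\<Rightarrow>\<^sub>0\<close> is the sum norm instead.\<close>

definition path_norm :: "'v chain \<Rightarrow> real" where
  "path_norm x = sqrt (path_inner x x)"

text \<open>Paths of degree \<open>0\<close> have boundary \<open>0\<close> (not the empty path).\<close>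

definition boundary :: "'v chain \<Rightarrow> 'v chain" where
  "boundary = lin_ext (\<lambda>xs. if length xs \<le> 1 then 0
     else (\<Sum>i<length xs. (- 1) ^ i *\<^sub>R elem (take i xs @ drop (Suc i) xs)))"

definition allowed :: "'v pair_pre_digraph \<Rightarrow> nat \<Rightarrow> 'v list \<Rightarrow> bool" where
  "allowed G n xs \<longleftrightarrow> length xs = n + 1 \<and> set xs \<subseteq> pverts G
     \<and> successively (\<lambda>u v. (u, v) \<in> parcs G) xs"

definition P_space :: "'v pair_pre_digraph \<Rightarrow> nat \<Rightarrow> 'v chain set" where
  "P_space G n = span (elem ` {xs. allowed G n xs})"

definition Omega :: "'v pair_pre_digraph \<Rightarrow> nat \<Rightarrow> 'v chain set" where
  "Omega G n = {x \<in> P_space G n. n = 0 \<or> boundary x \<in> P_space G (n - 1)}"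

definition Omega_star :: "'v pair_pre_digraph \<Rightarrow> 'v chain set" where
  "Omega_star G = span (\<Union>n. Omega G n)"

definition path_val :: "('v \<Rightarrow> real) \<Rightarrow> 'v list \<Rightarrow> real" where
  "path_val f xs = (\<Sum>v\<leftarrow>xs. f v)"

definition up_paths :: "'v pair_pre_digraph \<Rightarrow> ('v \<Rightarrow> real) \<Rightarrow> nat \<Rightarrow> 'v list \<Rightarrow> 'v list set" where
  "up_paths G f n xs =
     {ys. allowed G (n + 1) ys \<and> strict_subseq xs ys \<and> path_val f ys = path_val f xs}"

definition down_paths :: "'v pair_pre_digraph \<Rightarrow> ('v \<Rightarrow> real) \<Rightarrow> nat \<Rightarrow> 'v list \<Rightarrow> 'v list set" where
  "down_paths G f n xs = {ys. n > 0 \<and> allowed G (n - 1) ys \<and> strict_subseq ys xs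
     \<and> path_val f ys = path_val f xs}"

definition discrete_morse :: "'v pair_pre_digraph \<Rightarrow> ('v \<Rightarrow> real) \<Rightarrow> bool" where
  "discrete_morse G f \<longleftrightarrow> (\<forall>v \<in> pverts G. 0 \<le> f v) \<and>
     (\<forall>n xs. allowed G n xs \<longrightarrow> card (up_paths G f n xs) \<le> 1 \<and> card (down_paths G f n xs) \<le> 1)"

definition critical :: "'v pair_pre_digraph \<Rightarrow> ('v \<Rightarrow> real) \<Rightarrow> nat \<Rightarrow> 'v list \<Rightarrow> bool" where
  "critical G f n xs \<longleftrightarrow>
     allowed G n xs \<and> card (up_paths G f n xs) = 0 \<and> card (down_paths G f n xs) = 0"

definition Crit :: "'v pair_pre_digraph \<Rightarrow> ('v \<Rightarrow> real) \<Rightarrow> nat \<Rightarrow> 'v chain set" where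
  "Crit G f n = span (elem ` {xs. critical G f n xs})"

definition exp_op :: "('v \<Rightarrow> real) \<Rightarrow> real \<Rightarrow> 'v chain \<Rightarrow> 'v chain" where
  "exp_op f t = lin_ext (\<lambda>xs. exp (t * path_val f xs) *\<^sub>R elem xs)"

definition boundary_t :: "('v \<Rightarrow> real) \<Rightarrow> real \<Rightarrow> 'v chain \<Rightarrow> 'v chain" where
  "boundary_t f t x = exp_op f t (boundary (exp_op f (- t) x))"

text \<open>Adjoint, with respect to \<open>path_inner\<close>, of an endomorphism \<open>T\<close> of the subspace \<open>S\<close>.\<close>

definition adjoint_on :: "'v chain set \<Rightarrow> ('v chain \<Rightarrow> 'v chain) \<Rightarrow> 'v chain \<Rightarrow> 'v chain" where
  "adjoint_on S T y = (THE z. z \<in> S \<and> (\<forall>x \<in> S. path_inner (T x) y = path_inner x z))"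

text \<open>This is the Laplacian on all of \<open>Omega_star G\<close>; \<open>\<Delta>\<^sub>n(t)\<close> is its restriction to \<open>Omega G n\<close>.\<close>

definition Laplacian_t ::
    "'v pair_pre_digraph \<Rightarrow> ('v \<Rightarrow> real) \<Rightarrow> real \<Rightarrow> 'v chain \<Rightarrow> 'v chain" where
  "Laplacian_t G f t x =
     boundary_t f t (adjoint_on (Omega_star G) (boundary_t f t) x)
     + adjoint_on (Omega_star G) (boundary_t f t) (boundary_t f t x)"

definition eigenspace_on :: "'v chain set \<Rightarrow> ('v chain \<Rightarrow> 'v chain) \<Rightarrow> real \<Rightarrow> 'v chain set" where
  "eigenspace_on S T \<mu> = {x \<in> S. T x = \<mu> *\<^sub>R x}"

text \<open>
  The increasing list of the eigenvalues of a self-adjoint \<open>T\<close> on \<open>S\<close>, each repeated as often as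
  the dimension of its eigenspace; its length is \<open>dim S\<close>.
\<close>

definition eigenvalues_on :: "'v chain set \<Rightarrow> ('v chain \<Rightarrow> 'v chain) \<Rightarrow> real list" where
  "eigenvalues_on S T =
     (THE l. sorted l \<and> (\<forall>\<mu>. count_list l \<mu> = dim (eigenspace_on S T \<mu>)))"

definition eigenvalue_t :: "'v pair_pre_digraph \<Rightarrow> ('v \<Rightarrow> real) \<Rightarrow> nat \<Rightarrow> nat \<Rightarrow> real \<Rightarrow> real" where
  "eigenvalue_t G f n k t = eigenvalues_on (Omega G n) (Laplacian_t G f t) ! k"

text \<open>
  That an eigenvalue tends to \<open>0\<close> is a statement about a function of \<open>t\<close>: here, about the
  \<open>k\<close>-th smallest eigenvalue of \<open>\<Delta>\<^sub>n(t)\<close>, counted with multiplicity, for a fixed \<open>k\<close>.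
\<close>

definition W_space :: "'v pair_pre_digraph \<Rightarrow> ('v \<Rightarrow> real) \<Rightarrow> nat \<Rightarrow> real \<Rightarrow> 'v chain set" where
  "W_space G f n t =
     span (\<Union>k \<in> {k. k < dim (Omega G n) \<and> (eigenvalue_t G f n k \<longlongrightarrow> 0) at_top}.
             eigenspace_on (Omega G n) (Laplacian_t G f t) (eigenvalue_t G f n k t))"

definition orth_proj :: "'v chain set \<Rightarrow> 'v chain \<Rightarrow> 'v chain" where
  "orth_proj S x = (THE p. p \<in> S \<and> (\<forall>s \<in> S. path_inner (x - p) s = 0))"

text \<open>
  Convergence of subspaces of the finite-dimensional space \<open>A\<close>: the orthogonal projections
  converge in operator norm on \<open>A\<close>.
\<close>

definition subspaces_tendsto ::
    "'v chain set \<Rightarrow> ('t \<Rightarrow> 'v chain set) \<Rightarrow> 'v chain set \<Rightarrow> 't filter \<Rightarrow> bool" where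
  "subspaces_tendsto A S L F \<longleftrightarrow>
     (\<forall>\<epsilon>>0. \<forall>\<^sub>F t in F. \<forall>x \<in> A.
        path_norm (orth_proj (S t) x - orth_proj L x) \<le> \<epsilon> * path_norm x)"

end

theory Submission
  imports Defs
begin

text \<open>
  A transitive digraph without loops is a strict partial order, so its allowed paths are finite
  chains, every face of an allowed path is allowed, and distinct vertices give distinct faces. The
  matrix of \<open>\<partial>\<^sub>t\<close> in the basis of allowed paths has entries
  \<open>\<plusminus> exp (- t f(v))\<close>, where \<open>v\<close> is the removed vertex, and these converge to \<open>0\<close> or, if
  \<open>f(v) = 0\<close>, to \<open>\<plusminus> 1\<close>. The Morse condition leaves at most one nonzero entry in each row and
  column of the limit, so the limit of \<open>\<Delta>\<^sub>n(t)\<close> is diagonal; its diagonal entries are \<open>0\<close> at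
  the critical paths and at least \<open>1\<close> at all others. It remains to compare the small spectral
  subspace of a symmetric matrix near such a diagonal matrix with the kernel of the latter.
\<close>

subsection \<open>Symmetric bilinear forms on finite-dimensional subspaces\<close>

text \<open>Eigenvalues may cross and eigenvectors need not converge as \<open>t\<close> grows, so
  no limit of single eigenvectors is taken. Instead, for each \<open>t\<close> separately, two
  quadratic forms are compared: the energy, which is the sum of the squared norms of the boundary
  and of the coboundary, and its diagonal limit. They differ by at most \<open>\<epsilon> t\<close>
  times the squared norm, where \<open>\<epsilon> t\<close> is the sum of the absolute differences
  of the matrix entries. The limit form has a gap: its values on basis paths are 0 or at least 1.
  With c critical paths, min-max arguments place the c lowest eigenvalues in absolute value below
  \<open>\<epsilon> t\<close> and all others above \<open>1 - \<epsilon> t\<close>. This decides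
  which indices k satisfy the condition in \<open>W_space\<close>, a condition on whole functions of
  \<open>t\<close>, and it separates the corresponding eigenspaces from the remaining ones once
  \<open>\<epsilon> t < 1 / 2\<close>. The same gap bounds the squared distance of the two
  projections of x by \<open>6 * \<epsilon> t\<close> times the squared norm of x.\<close>

lemma bilinear_left: "bilinear h \<Longrightarrow> linear (\<lambda>x. h x y)"
  and bilinear_right: "bilinear h \<Longrightarrow> linear (h x)"
  by (simp_all add: bilinear_def)

text \<open>The type class norm of chains does not come from \<open>path_inner\<close>.
  Orthogonality is therefore developed for any positive definite form on a bare real vector space;
  finiteness enters only through the index sets of orthonormal families.\<close>

locale inner_form =
  fixes ip :: "'a::real_vector \<Rightarrow> 'a \<Rightarrow> real"
  assumes bilinear: "bilinear ip"
    and commute: "ip x y = ip y x"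
    and pos: "x \<noteq> 0 \<Longrightarrow> 0 < ip x x"
begin

lemmas add_left = bilinear_ladd[OF bilinear]
  and add_right = bilinear_radd[OF bilinear]
  and diff_left = bilinear_lsub[OF bilinear]
  and diff_right = bilinear_rsub[OF bilinear]
  and scale_left = bilinear_lmul[OF bilinear]
  and scale_right = bilinear_rmul[OF bilinear]
  and zero_left = bilinear_lzero[OF bilinear]
  and zero_right = bilinear_rzero[OF bilinear]
  and sum_left = linear_sum[OF bilinear_left[OF bilinear]]
  and sum_right = linear_sum[OF bilinear_right[OF bilinear]]

lemma nonneg: "0 \<le> ip x x"
  using pos[of x] by (cases "x = 0") (auto simp: zero_left)

lemma eq_zero_iff: "ip x x = 0 \<longleftrightarrow> x = 0"
  using pos[of x] by (cases "x = 0") (auto simp: zero_left)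

lemma Cauchy_Schwarz: "(ip x y)\<^sup>2 \<le> ip x x * ip y y"
proof (cases "y = 0")
  case False
  then have y: "0 < ip y y" by (rule pos)
  define r where "r = ip x y / ip y y"
  have r: "r * ip y y = ip x y" using y by (simp add: r_def)
  have "0 \<le> ip (x - r *\<^sub>R y) (x - r *\<^sub>R y)" by (rule nonneg)
  also have "\<dots> = ip x x - 2 * (r * ip x y) + r * (r * ip y y)"
    by (simp add: diff_left diff_right scale_left scale_right commute[of y x] algebra_simps)
  also have "\<dots> = ip x x - r * ip x y" by (simp add: r)
  finally have "r * ip x y * ip y y \<le> ip x x * ip y y"
    using y by simp
  then show ?thesis by (simp add: r_def power2_eq_square y less_imp_neq[OF y, symmetric])
qed (simp add: zero_right)

section \<open>Orthonormal families and the projections onto their spans\<close>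

definition orthonormal :: "('i \<Rightarrow> 'a) \<Rightarrow> 'i set \<Rightarrow> bool" where
  "orthonormal e I \<longleftrightarrow> (\<forall>i\<in>I. \<forall>j\<in>I. ip (e i) (e j) = (if i = j then 1 else 0))"

definition proj :: "('i \<Rightarrow> 'a) \<Rightarrow> 'i set \<Rightarrow> 'a \<Rightarrow> 'a" where
  "proj e I x = (\<Sum>i\<in>I. ip x (e i) *\<^sub>R e i)"

lemma orthonormalD: "orthonormal e I \<Longrightarrow> i \<in> I \<Longrightarrow> j \<in> I \<Longrightarrow> ip (e i) (e j) = (if i = j then 1 else 0)"
  by (simp add: orthonormal_def)

lemma orthonormal_subset: "orthonormal e I \<Longrightarrow> J \<subseteq> I \<Longrightarrow> orthonormal e J"
  unfolding orthonormal_def by blast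

lemma orthonormal_inj_on: "orthonormal e I \<Longrightarrow> inj_on e I"
  by (rule inj_onI) (metis orthonormalD zero_neq_one)

lemma span_orthogonal:
  assumes "\<And>i. i \<in> I \<Longrightarrow> ip x (e i) = 0" and "s \<in> span (e ` I)"
  shows "ip x s = 0"
  using assms(2)
  by (induction rule: span_induct_alt) (auto simp: zero_right add_right scale_right assms(1))

lemma orthonormal_independent:
  assumes "orthonormal e I"
  shows "independent (e ` I)"
proof
  assume "dependent (e ` I)"
  then obtain i where i: "i \<in> I" "e i \<in> span (e ` I - {e i})"
    unfolding dependent_def by auto
  have "span (e ` I - {e i}) \<subseteq> span (e ` (I - {i}))" by (rule span_mono) auto
  then have "e i \<in> span (e ` (I - {i}))" using i(2) by (rule subsetD)
  with _ have "ip (e i) (e i) = 0"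
    by (rule span_orthogonal) (use i(1) orthonormalD[OF assms] in auto)
  then show False using i assms by (simp add: orthonormalD)
qed

lemma dim_orthonormal: "orthonormal e I \<Longrightarrow> dim (span (e ` I)) = card I"
  by (simp add: dim_eq_card_independent orthonormal_independent card_image orthonormal_inj_on)

lemma proj_in_span: "proj e I x \<in> span (e ` I)"
  unfolding proj_def by (intro span_sum span_scale span_base) auto

lemma proj_coord:
  assumes "finite I" "orthonormal e I" "j \<in> I"
  shows "ip (proj e I x) (e j) = ip x (e j)"
proof -
  have "ip (proj e I x) (e j) = (\<Sum>i\<in>I. if i = j then ip x (e i) else 0)"
    unfolding proj_def sum_left scale_left using assms by (intro sum.cong) (auto simp: orthonormalD)
  then show ?thesis using assms by simp
qed

lemma proj_orthogonal:
  assumes "finite I" "orthonormal e I" "s \<in> span (e ` I)"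
  shows "ip (x - proj e I x) s = 0"
  by (rule span_orthogonal[OF _ assms(3)]) (simp add: diff_left proj_coord assms)

text \<open>The difference of two candidates lies in the span and is orthogonal to it, hence to
  itself. This lets the definite description \<open>orth_proj\<close> be computed from any
  orthonormal family that spans the subspace.\<close>

lemma proj_unique:
  assumes "finite I" "orthonormal e I" "p \<in> span (e ` I)"
    and "\<And>s. s \<in> span (e ` I) \<Longrightarrow> ip (x - p) s = 0"
  shows "p = proj e I x"
proof -
  let ?d = "p - proj e I x"
  have d: "?d \<in> span (e ` I)" by (intro span_diff assms proj_in_span)
  have "ip ?d ?d = ip (x - proj e I x) ?d - ip (x - p) ?d"
    by (simp add: diff_left)
  also have "\<dots> = 0" by (simp add: proj_orthogonal[OF assms(1,2) d] assms(4)[OF d])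
  finally show ?thesis by (simp add: eq_zero_iff)
qed

lemma proj_ident:
  assumes "finite I" "orthonormal e I" "x \<in> span (e ` I)"
  shows "proj e I x = x"
  by (rule proj_unique[symmetric]) (use assms in \<open>auto simp: zero_left\<close>)

lemma parseval:
  assumes "finite I" "orthonormal e I" "x \<in> span (e ` I)"
  shows "ip x y = (\<Sum>i\<in>I. ip x (e i) * ip y (e i))"
proof -
  have "ip x y = ip (proj e I x) y" using assms by (simp add: proj_ident)
  then show ?thesis unfolding proj_def sum_left scale_left by (simp add: commute)
qed

lemma pythagoras:
  assumes "finite I" "orthonormal e I"
  shows "ip x x = ip (proj e I x) (proj e I x) + ip (x - proj e I x) (x - proj e I x)"
proof -
  have "ip (x - proj e I x) (proj e I x) = 0" by (rule proj_orthogonal[OF assms proj_in_span])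
  then show ?thesis by (simp add: diff_left diff_right commute)
qed

lemma bilinear_proj_expand:
  assumes "bilinear Q" "finite I" "orthonormal e I" "x \<in> span (e ` I)" "y \<in> span (e ` I)"
  shows "Q x y = (\<Sum>i\<in>I. \<Sum>j\<in>I. ip x (e i) * ip y (e j) * Q (e i) (e j))"
proof -
  have "Q x y = Q (proj e I x) (proj e I y)" using assms by (simp add: proj_ident)
  also have "\<dots> = (\<Sum>i\<in>I. \<Sum>j\<in>I. ip x (e i) * ip y (e j) * Q (e i) (e j))"
    unfolding proj_def bilinear_sum[OF assms(1)] sum.cartesian_product
    by (intro sum.cong) (auto simp: bilinear_lmul[OF assms(1)] bilinear_rmul[OF assms(1)])
  finally show ?thesis .
qed

section \<open>Dimension counts, Rayleigh quotients and the spectral theorem\<close>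

text \<open>Fewer than \<open>card I\<close> linear conditions on a space of dimension
  \<open>card I\<close> have a common nonzero solution. The conditions are packed into an operator
  \<open>L\<close> with values in the span of the \<open>u j\<close>, which is too small for
  \<open>L\<close> to be injective. The \<open>u j\<close> may be linearly dependent.\<close>

lemma exists_unit_orthogonal:
  assumes "orthonormal c I" "finite I" "finite J" "card J < card I"
  obtains y where "y \<in> span (c ` I)" "ip y y = 1" "\<And>j. j \<in> J \<Longrightarrow> ip y (u j) = 0"
proof -
  define L where "L y = (\<Sum>j\<in>J. ip y (u j) *\<^sub>R u j)" for y
  have lin: "linear L"
    unfolding L_def by (rule linearI)
      (simp_all add: add_left scale_left scaleR_left_distrib sum.distrib scaleR_sum_right)
  have L: "L y \<in> span (u ` J)" for y
    unfolding L_def by (intro span_sum span_scale span_base) auto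
  have "\<not> inj_on L (span (c ` I))"
  proof
    assume inj: "inj_on L (span (c ` I))"
    have "independent (L ` c ` I)"
      by (rule linear_independent_injective_image[OF lin orthonormal_independent[OF assms(1)] inj])
    then have "card (L ` c ` I) \<le> card (u ` J)"
      using independent_span_bound[of "u ` J" "L ` c ` I"] L assms by auto
    moreover have "card (L ` c ` I) = card I"
      using inj_on_subset[OF inj span_superset] assms by (simp add: card_image orthonormal_inj_on)
    ultimately show False
      using card_image_le[OF assms(3), of u] assms(4) by simp
  qed
  then obtain a b where ab: "a \<in> span (c ` I)" "b \<in> span (c ` I)" "L a = L b" "a \<noteq> b"
    by (auto simp: inj_on_def)
  define z where "z = a - b"
  have z: "z \<in> span (c ` I)" "L z = 0" "z \<noteq> 0"
    using ab by (auto simp: z_def span_diff linear_diff[OF lin])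
  \<comment> \<open>Pairing \<open>L z = 0\<close> with \<open>z\<close> yields a sum of squares, so
    every single condition holds even if the \<open>u j\<close> are dependent.\<close>
  have "(\<Sum>j\<in>J. (ip z (u j))\<^sup>2) = ip z (L z)"
    unfolding L_def by (simp add: sum_right scale_right power2_eq_square)
  then have 0: "ip z (u j) = 0" if "j \<in> J" for j
    using that assms z by (simp add: zero_right sum_nonneg_eq_0_iff)
  have "0 < ip z z" using z pos by blast
  then show ?thesis
    using z 0 by (intro that[of "(1 / sqrt (ip z z)) *\<^sub>R z"])
      (auto simp: span_scale scale_left scale_right field_simps)
qed

text \<open>A continuous function attains its minimum on a compact set, here a set of coordinate
  functions \<open>c\<close> on the index type, since \<open>'a\<close> carries no topology.
  Homogeneity extends the minimum over unit vectors to all vectors that satisfy the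
  constraints.\<close>

lemma exists_rayleigh_minimizer:
  fixes u :: "nat \<Rightarrow> 'a" and b :: "'i \<Rightarrow> 'a"
  assumes "bilinear Q" "finite I" "orthonormal b I" "k < card I"
  obtains x where "x \<in> span (b ` I)" "ip x x = 1" "\<And>i. i < k \<Longrightarrow> ip x (u i) = 0"
    "\<And>y. y \<in> span (b ` I) \<Longrightarrow> (\<And>i. i < k \<Longrightarrow> ip y (u i) = 0) \<Longrightarrow> Q x x * ip y y \<le> Q y y"
proof -
  define v where "v c = (\<Sum>i\<in>I. c i *\<^sub>R b i)" for c :: "'i \<Rightarrow> real"
  have v_span: "v c \<in> span (b ` I)" for c
    unfolding v_def by (intro span_sum span_scale span_base) auto
  have v_coord: "ip (v c) y = (\<Sum>i\<in>I. c i * ip (b i) y)" for c y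
    by (simp add: v_def sum_left scale_left)
  have v_b: "ip (v c) (b j) = c j" if "j \<in> I" for c j
  proof -
    have "ip (v c) (b j) = (\<Sum>i\<in>I. if i = j then c i else 0)"
      unfolding v_coord using that assms by (intro sum.cong) (auto simp: orthonormalD)
    then show ?thesis using that assms by simp
  qed
  have v_norm: "ip (v c) (v c) = (\<Sum>i\<in>I. (c i)\<^sup>2)" for c
    using parseval[OF assms(2,3) v_span[of c], of "v c"]
    by (simp add: v_b power2_eq_square)
  have v_Q: "Q (v c) (v c) = (\<Sum>i\<in>I. \<Sum>j\<in>I. c i * c j * Q (b i) (b j))" for c
    using bilinear_proj_expand[OF assms(1-3) v_span[of c] v_span[of c]] by (simp add: v_b)
  \<comment> \<open>Coordinates outside \<open>I\<close> are pinned to 0, so that \<open>K\<close>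
    is a product of compact sets over the whole index type and Tychonoff's theorem applies.\<close>
  define K where "K = PiE UNIV (\<lambda>i. if i \<in> I then {-1..1} else {0::real})"
  define F where "F = {c. (\<Sum>i\<in>I. (c i)\<^sup>2) = 1} \<inter> (\<Inter>j<k. {c. (\<Sum>i\<in>I. c i * ip (b i) (u j)) = 0})"
  have "compactin (product_topology (\<lambda>i. euclidean) UNIV) K"
    unfolding K_def compactin_PiE by auto
  then have "compact K" by (simp add: euclidean_product_topology)
  moreover have "closed F"
    unfolding F_def
    by (intro closed_Int closed_INT ballI closed_Collect_eq continuous_intros
        continuous_on_product_coordinates)
  ultimately have comp: "compact (K \<inter> F)" by (rule compact_Int_closed)
  have KF: "\<exists>c\<in>K \<inter> F. v c = y"
    if y: "y \<in> span (b ` I)" "ip y y = 1" "\<And>i. i < k \<Longrightarrow> ip y (u i) = 0" for y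
  proof -
    define c where "c i = (if i \<in> I then ip y (b i) else 0)" for i
    have vc: "v c = y"
      using proj_ident[OF assms(2,3) y(1)] by (simp add: v_def c_def proj_def)
    have n: "(\<Sum>i\<in>I. (c i)\<^sup>2) = 1" using v_norm[of c] vc y by simp
    have "(c i)\<^sup>2 \<le> 1" for i
    proof (cases "i \<in> I")
      case True
      then show ?thesis using member_le_sum[of i I "\<lambda>i. (c i)\<^sup>2"] n assms by simp
    qed (simp add: c_def)
    then have "\<bar>c i\<bar> \<le> 1" for i by (simp add: abs_square_le_1)
    then have "-1 \<le> c i" "c i \<le> 1" for i by (auto simp: abs_le_iff minus_le_iff)
    then have "c \<in> K" unfolding K_def by (intro PiE_I) (auto, simp add: c_def)
    moreover have "c \<in> F" using n v_coord[of c] vc y by (auto simp: F_def)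
    ultimately show ?thesis using vc by blast
  qed
  obtain y0 where "y0 \<in> span (b ` I)" "ip y0 y0 = 1" "\<And>i. i < k \<Longrightarrow> ip y0 (u i) = 0"
    using exists_unit_orthogonal[OF assms(3,2), of "{..<k}" u] assms(4) by auto
  then have ne: "K \<inter> F \<noteq> {}" using KF by blast
  have "continuous_on (K \<inter> F) (\<lambda>c. \<Sum>i\<in>I. \<Sum>j\<in>I. c i * c j * Q (b i) (b j))"
    by (intro continuous_intros continuous_on_subset[OF continuous_on_product_coordinates]) auto
  from continuous_attains_inf[OF comp ne this]
  obtain c where c: "c \<in> K \<inter> F" "\<And>c'. c' \<in> K \<inter> F \<Longrightarrow> Q (v c) (v c) \<le> Q (v c') (v c')"
    unfolding v_Q by auto
  show ?thesis
  proof (rule that[of "v c"])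
    show "v c \<in> span (b ` I)" by (rule v_span)
    show "ip (v c) (v c) = 1" using c(1) by (simp add: v_norm F_def)
    show "ip (v c) (u i) = 0" if "i < k" for i using that c(1) by (simp add: v_coord F_def)
    fix y assume y: "y \<in> span (b ` I)" "\<And>i. i < k \<Longrightarrow> ip y (u i) = 0"
    show "Q (v c) (v c) * ip y y \<le> Q y y"
    proof (cases "y = 0")
      case False
      then have y0: "0 < ip y y" by (rule pos)
      let ?r = "1 / sqrt (ip y y)"
      have "\<exists>c'\<in>K \<inter> F. v c' = ?r *\<^sub>R y"
        using y y0 by (intro KF) (auto simp: span_scale scale_left scale_right)
      then have "Q (v c) (v c) \<le> Q (?r *\<^sub>R y) (?r *\<^sub>R y)" using c(2) by metis
      also have "\<dots> = Q y y / ip y y"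
        using y0 by (simp add: bilinear_lmul[OF assms(1)] bilinear_rmul[OF assms(1)])
      finally show ?thesis using y0 by (simp add: field_simps)
    qed (simp add: bilinear_lzero[OF assms(1)] zero_left)
  qed
qed

text \<open>The eigenvector equation is stated weakly, through the bilinear form of the operator.\<close>

definition eigenbasis :: "('a \<Rightarrow> 'a \<Rightarrow> real) \<Rightarrow> 'a set \<Rightarrow> nat \<Rightarrow> (nat \<Rightarrow> 'a) \<Rightarrow> (nat \<Rightarrow> real) \<Rightarrow> bool" where
  "eigenbasis Q S N e \<nu> \<longleftrightarrow> orthonormal e {..<N} \<and> span (e ` {..<N}) = S \<and>
     (\<forall>i<N. \<forall>y\<in>S. Q (e i) y = \<nu> i * ip (e i) y) \<and> (\<forall>i j. i \<le> j \<longrightarrow> j < N \<longrightarrow> \<nu> i \<le> \<nu> j)"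

text \<open>First variation: \<open>Q\<close> minus \<open>Q x x\<close> times \<open>ip\<close> is
  nonnegative on \<open>S\<close> and vanishes at \<open>x\<close>. Moving from \<open>x\<close> by
  \<open>s *\<^sub>R y\<close> gives a nonnegative polynomial in s without constant term, so its
  linear coefficient \<open>2 * a\<close> is 0.\<close>

lemma rayleigh_minimizer_eigenvector:
  assumes Q: "bilinear Q" "\<And>x y. Q x y = Q y x"
    and S: "subspace S" and x: "x \<in> S" "ip x x = 1"
    and min: "\<And>y. y \<in> S \<Longrightarrow> Q x x * ip y y \<le> Q y y"
    and y: "y \<in> S"
  shows "Q x y = Q x x * ip x y"
proof -
  define a where "a = Q x y - Q x x * ip x y"
  define d where "d = Q y y - Q x x * ip y y"
  have d: "0 \<le> d" using min[OF y] by (simp add: d_def)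
  have q: "0 \<le> 2 * s * a + s\<^sup>2 * d" for s
  proof -
    have "x + s *\<^sub>R y \<in> S" using S x y by (intro subspace_add subspace_scale)
    from min[OF this]
    have "Q x x * (1 + 2 * s * ip x y + s\<^sup>2 * ip y y) \<le> Q x x + 2 * s * Q x y + s\<^sup>2 * Q y y"
      by (simp add: x add_left add_right scale_left scale_right commute[of y x] Q(2)[of y x]
          bilinear_ladd[OF Q(1)] bilinear_radd[OF Q(1)] bilinear_lmul[OF Q(1)]
          bilinear_rmul[OF Q(1)] power2_eq_square algebra_simps)
    then show ?thesis by (simp add: a_def d_def algebra_simps)
  qed
  have "a = 0"
  proof (rule ccontr)
    assume "a \<noteq> 0"
    \<comment> \<open>The value s = -r makes the polynomial negative; \<open>1 + d\<close> in place
      of \<open>d\<close> also covers \<open>d = 0\<close>.\<close>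
    define r where "r = a / (1 + d)"
    have r: "a = r * (1 + d)" using d by (simp add: r_def)
    have "0 \<le> 2 * (- r) * a + (- r)\<^sup>2 * d" by (rule q)
    also have "\<dots> = - (r\<^sup>2) * (2 + d)" by (simp add: r power2_eq_square algebra_simps)
    also have "\<dots> < 0" using \<open>a \<noteq> 0\<close> d by (intro mult_neg_pos) (auto simp: r)
    finally show False by simp
  qed
  then show ?thesis by (simp add: a_def)
qed

text \<open>Each new eigenvector minimizes the Rayleigh quotient on the orthogonal complement of the
  previous ones, which produces the eigenvalues in increasing order.\<close>

theorem spectral_theorem:
  fixes b :: "'i \<Rightarrow> 'a"
  assumes Q: "bilinear Q" "\<And>x y. Q x y = Q y x" and I: "finite I" "orthonormal b I"
  obtains e \<nu> where "eigenbasis Q (span (b ` I)) (card I) e \<nu>"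
proof -
  let ?S = "span (b ` I)"
  \<comment> \<open>The last conjunct, minimality of \<open>\<nu> i\<close> on the complement of the
    earlier vectors, is carried along because it gives the monotonicity of \<open>\<nu>\<close> at
    the end.\<close>
  have "\<exists>e \<nu>. orthonormal e {..<n} \<and> (\<forall>i<n. e i \<in> ?S) \<and>
     (\<forall>i<n. \<forall>y\<in>?S. Q (e i) y = \<nu> i * ip (e i) y) \<and>
     (\<forall>i<n. \<forall>y\<in>?S. (\<forall>j<i. ip y (e j) = 0) \<longrightarrow> \<nu> i * ip y y \<le> Q y y)"
    if "n \<le> card I" for n
    using that
  proof (induction n)
    case 0
    then show ?case by (auto simp: orthonormal_def)
  next
    case (Suc n)
    from Suc.IH[OF Suc_leD[OF Suc.prems]]
    obtain e \<nu> where e': "orthonormal e {..<n}" "\<forall>i<n. e i \<in> ?S"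
      "\<forall>i<n. \<forall>y\<in>?S. Q (e i) y = \<nu> i * ip (e i) y"
      "\<forall>i<n. \<forall>y\<in>?S. (\<forall>j<i. ip y (e j) = 0) \<longrightarrow> \<nu> i * ip y y \<le> Q y y"
      by (elim exE conjE)
    note e = e'(1) e'(2-4)[rule_format]
    obtain x where x: "x \<in> ?S" "ip x x = 1" "\<And>i. i < n \<Longrightarrow> ip x (e i) = 0"
      "\<And>y. y \<in> ?S \<Longrightarrow> (\<And>i. i < n \<Longrightarrow> ip y (e i) = 0) \<Longrightarrow> Q x x * ip y y \<le> Q y y"
      using exists_rayleigh_minimizer[OF Q(1) I, of n e] Suc.prems by auto
    \<comment> \<open>Minimality gives the eigenvector equation only on the complement of the
      earlier \<open>e i\<close>. On their span both sides vanish, because each \<open>e i\<close>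
      is an eigenvector orthogonal to \<open>x\<close>.\<close>
    have eig: "Q x y = Q x x * ip x y" if y: "y \<in> ?S" for y
    proof -
      let ?p = "proj e {..<n} y"
      have pS: "?p \<in> ?S"
        unfolding proj_def by (intro span_sum span_scale e) auto
      have "Q x (e i) = 0" if "i < n" for i
        using e(3)[OF that x(1)] x(3)[OF that] Q(2)[of x "e i"] commute[of x "e i"] by simp
      then have p0: "ip x ?p = 0" "Q x ?p = 0"
        using x(3) by (simp_all add: proj_def sum_right scale_right
            linear_sum[OF bilinear_right[OF Q(1)]] bilinear_rmul[OF Q(1)])
      have "subspace (?S \<inter> {y. \<forall>i<n. ip y (e i) = 0})"
        by (auto simp: subspace_def zero_left add_left scale_left span_zero span_add span_scale)
      from rayleigh_minimizer_eigenvector[OF Q this, of x "y - ?p"]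
      have "Q x (y - ?p) = Q x x * ip x (y - ?p)"
        using x y pS e(1) by (auto simp: span_diff diff_left proj_coord)
      then show ?thesis using p0 by (simp add: diff_right bilinear_rsub[OF Q(1)])
    qed
    have x': "ip (e i) x = 0" if "i < n" for i using x(3)[OF that] commute by metis
    let ?e = "e(n := x)" and ?\<nu> = "\<nu>(n := Q x x)"
    have "orthonormal ?e {..<Suc n}"
      using e(1) x(2,3) x' by (auto simp: orthonormal_def less_Suc_eq)
    moreover have "\<forall>i<Suc n. ?e i \<in> ?S"
      using e(2) x(1) by (simp add: less_Suc_eq)
    moreover have "\<forall>i<Suc n. \<forall>y\<in>?S. Q (?e i) y = ?\<nu> i * ip (?e i) y"
      using e(3) eig by (simp add: less_Suc_eq)
    moreover have "?\<nu> i * ip y y \<le> Q y y"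
      if i: "i < Suc n" and y: "y \<in> ?S" "\<forall>j<i. ip y (?e j) = 0" for i y
    proof -
      have "ip y (e j) = 0" if "j < i" for j
        using y(2)[rule_format, OF that] that i by (simp split: if_splits)
      then show ?thesis
        using e(4)[of i y] x(4)[of y] i y(1) by (cases "i = n") auto
    qed
    ultimately show ?case by blast
  qed
  from this[OF order_refl] obtain e \<nu> where e': "orthonormal e {..<card I}"
    "\<forall>i<card I. e i \<in> ?S"
    "\<forall>i<card I. \<forall>y\<in>?S. Q (e i) y = \<nu> i * ip (e i) y"
    "\<forall>i<card I. \<forall>y\<in>?S. (\<forall>j<i. ip y (e j) = 0) \<longrightarrow> \<nu> i * ip y y \<le> Q y y"
    by (elim exE conjE)
  note e = e'(1) e'(2-4)[rule_format]
  have sub: "span (e ` {..<card I}) \<subseteq> ?S"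
    using e(2) by (intro span_minimal subspace_span) auto
  have "?S \<subseteq> span (e ` {..<card I})"
  proof
    fix x assume x: "x \<in> ?S"
    show "x \<in> span (e ` {..<card I})"
    proof (rule ccontr)
      assume "x \<notin> span (e ` {..<card I})"
      then have "independent (insert x (e ` {..<card I}))"
        using orthonormal_independent[OF e(1)] by (simp add: independent_insertI)
      moreover have "x \<notin> e ` {..<card I}"
        using \<open>x \<notin> span (e ` {..<card I})\<close> by (rule contrapos_nn) (rule span_base)
      then have "card (insert x (e ` {..<card I})) = Suc (card I)"
        using orthonormal_inj_on[OF e(1)] by (simp add: card_image)
      moreover have "insert x (e ` {..<card I}) \<subseteq> ?S" using x e(2) by auto
      ultimately have "Suc (card I) \<le> card (b ` I)"
        using independent_span_bound[of "b ` I" "insert x (e ` {..<card I})"] I by auto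
      then show False using card_image_le[OF I(1), of b] by simp
    qed
  qed
  moreover have "\<nu> i \<le> \<nu> j" if "i \<le> j" "j < card I" for i j
  proof -
    have "\<nu> i * ip (e j) (e j) \<le> Q (e j) (e j)"
      using that e(1) e(2)[of j] by (intro e(4)) (auto simp: orthonormalD)
    then show ?thesis using e(1) e(3)[OF that(2) e(2)[OF that(2)]] that by (simp add: orthonormalD)
  qed
  ultimately have "eigenbasis Q ?S (card I) e \<nu>"
    using sub e(1) e'(3) unfolding eigenbasis_def by blast
  then show ?thesis by (rule that)
qed

text \<open>By symmetry of \<open>Q\<close>, an eigenvector for \<mu> is orthogonal to every
  \<open>e i\<close> with another eigenvalue. Multiplicities thus become cardinalities of index
  sets, also for a \<mu> that is no eigenvalue, where both sides are zero spaces.\<close>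

lemma eigenspace_eq_span:
  assumes Q: "bilinear Q" "\<And>x y. Q x y = Q y x" and e: "eigenbasis Q S N e \<nu>"
  shows "{x \<in> S. \<forall>y\<in>S. Q x y = \<mu> * ip x y} = span (e ` {i. i < N \<and> \<nu> i = \<mu>})"
proof
  have S: "span (e ` {..<N}) = S" using e by (simp add: eigenbasis_def)
  have eS: "e i \<in> S" if "i < N" for i
    unfolding S[symmetric] using that by (intro span_base) auto
  show "span (e ` {i. i < N \<and> \<nu> i = \<mu>}) \<subseteq> {x \<in> S. \<forall>y\<in>S. Q x y = \<mu> * ip x y}"
  proof (rule span_minimal)
    show "e ` {i. i < N \<and> \<nu> i = \<mu>} \<subseteq> {x \<in> S. \<forall>y\<in>S. Q x y = \<mu> * ip x y}"
      using e eS by (auto simp: eigenbasis_def)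
    have "subspace S" using S by (metis subspace_span)
    then show "subspace {x \<in> S. \<forall>y\<in>S. Q x y = \<mu> * ip x y}"
      by (auto simp: subspace_def zero_left add_left scale_left bilinear_lzero[OF Q(1)]
          bilinear_ladd[OF Q(1)] bilinear_lmul[OF Q(1)] algebra_simps)
  qed
  show "{x \<in> S. \<forall>y\<in>S. Q x y = \<mu> * ip x y} \<subseteq> span (e ` {i. i < N \<and> \<nu> i = \<mu>})"
  proof clarify
    fix x assume x: "x \<in> S" "\<forall>y\<in>S. Q x y = \<mu> * ip x y"
    have 0: "ip x (e i) = 0" if "i < N" "\<nu> i \<noteq> \<mu>" for i
    proof -
      have "\<nu> i * ip x (e i) = Q (e i) x"
        using e that x commute[of x "e i"] by (simp add: eigenbasis_def)
      also have "\<dots> = \<mu> * ip x (e i)" using x eS[OF that(1)] Q(2)[of "e i" x] by simp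
      finally show ?thesis using that by simp
    qed
    have "ip x (e i) *\<^sub>R e i \<in> span (e ` {i. i < N \<and> \<nu> i = \<mu>})" if "i < N" for i
    proof (cases "\<nu> i = \<mu>")
      case True
      then show ?thesis using that by (intro span_scale span_base) auto
    qed (use that 0 in \<open>auto simp: span_zero\<close>)
    then have "proj e {..<N} x \<in> span (e ` {i. i < N \<and> \<nu> i = \<mu>})"
      unfolding proj_def by (intro span_sum) auto
    moreover have "proj e {..<N} x = x"
      using e x S by (intro proj_ident) (auto simp: eigenbasis_def)
    ultimately show "x \<in> span (e ` {i. i < N \<and> \<nu> i = \<mu>})" by simp
  qed
qed

lemma eigenbasis_expand:
  assumes Q: "bilinear Q" and e: "eigenbasis Q S N e \<nu>" and x: "x \<in> S"
  shows "Q x x = (\<Sum>i<N. \<nu> i * (ip x (e i))\<^sup>2)"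
proof -
  have "proj e {..<N} x = x"
    using e x by (intro proj_ident) (auto simp: eigenbasis_def)
  then have "Q x x = Q (proj e {..<N} x) x" by simp
  also have "\<dots> = (\<Sum>i<N. ip x (e i) * Q (e i) x)"
    by (simp add: proj_def linear_sum[OF bilinear_left[OF Q]] bilinear_lmul[OF Q])
  also have "\<dots> = (\<Sum>i<N. \<nu> i * (ip x (e i))\<^sup>2)"
  proof (intro sum.cong refl)
    fix i assume "i \<in> {..<N}"
    then have "Q (e i) x = \<nu> i * ip x (e i)"
      using e x commute[of x "e i"] by (simp add: eigenbasis_def)
    then show "ip x (e i) * Q (e i) x = \<nu> i * (ip x (e i))\<^sup>2"
      by (simp add: power2_eq_square)
  qed
  finally show ?thesis .
qed

section \<open>Quadratic forms near a diagonal form with a spectral gap\<close>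

text \<open>Every product of two coordinates of \<open>x\<close> is at most \<open>ip x x\<close> in
  absolute value. The entrywise sum is a crude norm, but it tends to 0 as soon as every entry
  does.\<close>

lemma quadratic_form_close:
  assumes Q: "bilinear Q" and I: "finite I" "orthonormal b I" and x: "x \<in> span (b ` I)"
  shows "\<bar>Q x x - (\<Sum>i\<in>I. d i * (ip x (b i))\<^sup>2)\<bar>
    \<le> (\<Sum>i\<in>I. \<Sum>j\<in>I. \<bar>Q (b i) (b j) - (if i = j then d i else 0)\<bar>) * ip x x"
proof -
  let ?D = "\<lambda>i j. Q (b i) (b j) - (if i = j then d i else 0)"
  have n: "ip x x = (\<Sum>i\<in>I. (ip x (b i))\<^sup>2)"
    using parseval[OF I x, of x] by (simp add: power2_eq_square)
  have sq: "(ip x (b i))\<^sup>2 \<le> ip x x" if "i \<in> I" for i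
    unfolding n using that I by (intro member_le_sum) auto
  have bound: "\<bar>ip x (b i) * ip x (b j)\<bar> \<le> ip x x" if "i \<in> I" "j \<in> I" for i j
  proof -
    have "2 * \<bar>ip x (b i) * ip x (b j)\<bar> \<le> (ip x (b i))\<^sup>2 + (ip x (b j))\<^sup>2"
      using sum_squares_bound[of "\<bar>ip x (b i)\<bar>" "\<bar>ip x (b j)\<bar>"] by (simp add: abs_mult)
    then show ?thesis using sq[OF that(1)] sq[OF that(2)] by simp
  qed
  have "(\<Sum>i\<in>I. d i * (ip x (b i))\<^sup>2)
      = (\<Sum>i\<in>I. \<Sum>j\<in>I. ip x (b i) * ip x (b j) * (if i = j then d i else 0))"
    using I by (intro sum.cong refl)
      (simp add: if_distrib[of "\<lambda>z. _ * z"] power2_eq_square cong: if_cong)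
  then have "Q x x - (\<Sum>i\<in>I. d i * (ip x (b i))\<^sup>2)
      = (\<Sum>i\<in>I. \<Sum>j\<in>I. ip x (b i) * ip x (b j) * ?D i j)"
    by (simp add: bilinear_proj_expand[OF Q I x x] right_diff_distrib sum_subtractf)
  also have "\<bar>\<dots>\<bar> \<le> (\<Sum>i\<in>I. \<Sum>j\<in>I. \<bar>ip x (b i) * ip x (b j) * ?D i j\<bar>)"
    by (rule order_trans[OF sum_abs sum_mono[OF sum_abs]])
  also have "\<dots> \<le> (\<Sum>i\<in>I. \<Sum>j\<in>I. \<bar>?D i j\<bar> * ip x x)"
  proof (intro sum_mono)
    fix i j assume "i \<in> I" "j \<in> I"
    then show "\<bar>ip x (b i) * ip x (b j) * ?D i j\<bar> \<le> \<bar>?D i j\<bar> * ip x x"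
      using mult_left_mono[OF bound[of i j], of "\<bar>?D i j\<bar>"] by (simp add: abs_mult mult_ac)
  qed
  finally show ?thesis by (simp add: sum_distrib_right)
qed

text \<open>\<open>C\<close> indexes the kernel of the diagonal form and 1 is its gap.
  \<open>Q\<close> is near this form but is not assumed nonnegative, hence the two-sided bound on
  small eigenvalues below.\<close>

context
  fixes Q :: "'a \<Rightarrow> 'a \<Rightarrow> real" and I :: "'i set" and b :: "'i \<Rightarrow> 'a" and d :: "'i \<Rightarrow> real"
    and C :: "'i set" and e :: "nat \<Rightarrow> 'a" and \<nu> :: "nat \<Rightarrow> real" and \<epsilon> :: real
  assumes Q: "bilinear Q" "\<And>x y. Q x y = Q y x"
    and I: "finite I" "orthonormal b I"
    and C: "C \<subseteq> I" and d_0: "\<And>i. i \<in> C \<Longrightarrow> d i = 0" and d_1: "\<And>i. i \<in> I - C \<Longrightarrow> 1 \<le> d i"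
    and e: "eigenbasis Q (span (b ` I)) (card I) e \<nu>"
    and close: "\<And>x. x \<in> span (b ` I) \<Longrightarrow>
      \<bar>Q x x - (\<Sum>i\<in>I. d i * (ip x (b i))\<^sup>2)\<bar> \<le> \<epsilon> * ip x x"
begin

lemma e_orthonormal: "J \<subseteq> {..<card I} \<Longrightarrow> orthonormal e J"
  and e_span: "span (e ` {..<card I}) = span (b ` I)"
  and e_mono: "i \<le> j \<Longrightarrow> j < card I \<Longrightarrow> \<nu> i \<le> \<nu> j"
  using e by (auto simp: eigenbasis_def intro: orthonormal_subset)

lemma C_orthonormal: "finite C" "orthonormal b C" "card C \<le> card I" "span (b ` C) \<subseteq> span (b ` I)"
  using C I by (auto intro: finite_subset orthonormal_subset card_mono span_mono[THEN subsetD, rotated])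

lemma ip_expand:
  assumes "x \<in> span (b ` I)"
  shows "ip x x = (\<Sum>i\<in>I. (ip x (b i))\<^sup>2)" "ip x x = (\<Sum>i<card I. (ip x (e i))\<^sup>2)"
  using parseval[OF I, of x x] parseval[OF _ e_orthonormal[OF order_refl], of x x] assms e_span
  by (simp_all add: power2_eq_square)

lemma d_nonneg: "i \<in> I \<Longrightarrow> 0 \<le> d i"
  using d_0 d_1 by (cases "i \<in> C") (auto intro: order_trans[OF zero_le_one])

lemma diagonal_sum_critical:
  assumes "y \<in> span (b ` C)"
  shows "(\<Sum>i\<in>I. d i * (ip y (b i))\<^sup>2) = 0"
proof (intro sum.neutral ballI)
  fix i assume i: "i \<in> I"
  show "d i * (ip y (b i))\<^sup>2 = 0"
  proof (cases "i \<in> C")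
    case False
    then have "ip (b i) (b j) = 0" if "j \<in> C" for j
      using orthonormalD[OF I(2) i, of j] C that by auto
    then have "ip (b i) y = 0" by (rule span_orthogonal[OF _ assms])
    then show ?thesis by (simp add: commute)
  qed (simp add: d_0)
qed

text \<open>Upper half of min-max: the \<open>b i\<close> with i in \<open>C\<close> span a space of
  dimension above \<open>k\<close>, so it contains a unit vector orthogonal to the first
  \<open>k\<close> eigenvectors. There \<open>Q\<close> is at least \<open>\<nu> k\<close>, while
  the diagonal form is 0. The lower bound is the nonnegativity of the diagonal form at
  \<open>e k\<close>.\<close>

lemma eigenvalue_small:
  assumes k: "k < card C"
  shows "\<bar>\<nu> k\<bar> \<le> \<epsilon>"
proof -
  have kI: "k < card I" using k C_orthonormal by simp
  obtain y where y: "y \<in> span (b ` C)" "ip y y = 1" "\<And>i. i \<in> {..<k} \<Longrightarrow> ip y (e i) = 0"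
    using exists_unit_orthogonal[OF C_orthonormal(2,1), of "{..<k}" e] k by auto
  have yI: "y \<in> span (b ` I)" using y C_orthonormal by auto
  have "\<nu> k * ip y y = (\<Sum>i<card I. \<nu> k * (ip y (e i))\<^sup>2)"
    by (simp add: ip_expand(2)[OF yI] sum_distrib_left)
  also have "\<dots> \<le> (\<Sum>i<card I. \<nu> i * (ip y (e i))\<^sup>2)"
  proof (rule sum_mono)
    fix i assume "i \<in> {..<card I}"
    then show "\<nu> k * (ip y (e i))\<^sup>2 \<le> \<nu> i * (ip y (e i))\<^sup>2"
      using y(3)[of i] e_mono[of k i] by (cases "i < k") (auto intro: mult_right_mono)
  qed
  also have "\<dots> = Q y y" by (rule eigenbasis_expand[OF Q(1) e yI, symmetric])
  also have "\<dots> \<le> \<epsilon>" using close[OF yI] y diagonal_sum_critical by auto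
  finally have up: "\<nu> k \<le> \<epsilon>" using y by simp
  have ek: "e k \<in> span (b ` I)" unfolding e_span[symmetric] using kI by (intro span_base) auto
  have n: "ip (e k) (e k) = 1" using e_orthonormal[OF order_refl] kI by (simp add: orthonormalD)
  have "Q (e k) (e k) = \<nu> k" using e ek kI n by (simp add: eigenbasis_def)
  moreover have "0 \<le> (\<Sum>i\<in>I. d i * (ip (e k) (b i))\<^sup>2)"
    by (intro sum_nonneg mult_nonneg_nonneg d_nonneg) auto
  ultimately show ?thesis using close[OF ek] n up by simp
qed

text \<open>Lower half of min-max: the first \<open>k + 1\<close> eigenvectors span more than
  \<open>card C\<close> dimensions, so some unit vector there has no coordinate in \<open>C\<close>.
  The diagonal form is at least 1 at it, and \<open>Q\<close> is at most
  \<open>\<nu> k\<close>.\<close>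

lemma eigenvalue_large:
  assumes k: "card C \<le> k" "k < card I"
  shows "1 - \<epsilon> \<le> \<nu> k"
proof -
  have K: "{..k} \<subseteq> {..<card I}" using k by auto
  obtain y where y: "y \<in> span (e ` {..k})" "ip y y = 1" "\<And>i. i \<in> C \<Longrightarrow> ip y (b i) = 0"
    using exists_unit_orthogonal[OF e_orthonormal[OF K] _ C_orthonormal(1), of b] k by auto
  have yI: "y \<in> span (b ` I)"
    using y(1) span_mono[OF image_mono[OF K], of e] by (auto simp: e_span)
  have e0: "ip y (e i) = 0" if "k < i" "i < card I" for i
  proof -
    have "ip (e i) (e j) = 0" if "j \<in> {..k}" for j
      using orthonormalD[OF e_orthonormal[OF order_refl], of i j] that \<open>k < i\<close> \<open>i < card I\<close> by auto
    then have "ip (e i) y = 0" by (rule span_orthogonal[OF _ y(1)])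
    then show ?thesis by (simp add: commute)
  qed
  have "1 = (\<Sum>i\<in>I. (ip y (b i))\<^sup>2)" using ip_expand(1)[OF yI] y by simp
  also have "\<dots> \<le> (\<Sum>i\<in>I. d i * (ip y (b i))\<^sup>2)"
  proof (rule sum_mono)
    fix i assume "i \<in> I"
    then show "(ip y (b i))\<^sup>2 \<le> d i * (ip y (b i))\<^sup>2"
      using y(3)[of i] mult_right_mono[OF d_1[of i], of "(ip y (b i))\<^sup>2"] by (cases "i \<in> C") auto
  qed
  also have "\<dots> \<le> Q y y + \<epsilon>" using close[OF yI] y by auto
  also have "Q y y = (\<Sum>i<card I. \<nu> i * (ip y (e i))\<^sup>2)"
    by (rule eigenbasis_expand[OF Q(1) e yI])
  also have "\<dots> \<le> (\<Sum>i<card I. \<nu> k * (ip y (e i))\<^sup>2)"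
  proof (rule sum_mono)
    fix i assume "i \<in> {..<card I}"
    then show "\<nu> i * (ip y (e i))\<^sup>2 \<le> \<nu> k * (ip y (e i))\<^sup>2"
      using e0[of i] e_mono[of i k] k by (cases "k < i") (auto intro: mult_right_mono)
  qed
  also have "\<dots> = \<nu> k * ip y y"
    by (simp add: ip_expand(2)[OF yI] sum_distrib_left)
  finally show ?thesis using y by simp
qed

text \<open>As \<open>d\<close> is at least 1 off \<open>C\<close>, the diagonal form dominates the
  squared distance to the span of the kernel vectors. One \<epsilon> comes from the eigenvalue bound
  on \<open>Q\<close>, the other from passing from \<open>Q\<close> to the diagonal form.\<close>

lemma proj_close_small:
  assumes "x \<in> span (e ` {..<card C})"
  shows "ip (x - proj b C x) (x - proj b C x) \<le> 2 * \<epsilon> * ip x x"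
proof -
  have sub: "{..<card C} \<subseteq> {..<card I}" using C_orthonormal by auto
  have xI: "x \<in> span (b ` I)"
    using assms span_mono[OF image_mono[OF sub], of e] by (auto simp: e_span)
  have r: "x - proj b C x \<in> span (b ` I)"
    using xI C_orthonormal(4) proj_in_span[of b C x] by (intro span_diff) auto
  have e0: "ip x (e i) = 0" if "card C \<le> i" "i < card I" for i
  proof -
    have "ip (e i) (e j) = 0" if "j \<in> {..<card C}" for j
      using orthonormalD[OF e_orthonormal[OF order_refl], of i j] that \<open>card C \<le> i\<close> \<open>i < card I\<close>
      by auto
    then have "ip (e i) x = 0" by (rule span_orthogonal[OF _ assms])
    then show ?thesis by (simp add: commute)
  qed
  have rc: "ip (x - proj b C x) (b i) = (if i \<in> C then 0 else ip x (b i))" if i: "i \<in> I" for i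
  proof (cases "i \<in> C")
    case True
    then show ?thesis using proj_coord[OF C_orthonormal(1,2)] by (simp add: diff_left)
  next
    case False
    then have "ip (b i) (b j) = 0" if "j \<in> C" for j
      using orthonormalD[OF I(2) i, of j] C that by auto
    then have "ip (b i) (proj b C x) = 0" by (rule span_orthogonal[OF _ proj_in_span])
    then show ?thesis using False by (simp add: diff_left commute[of _ "proj b C x"])
  qed
  have "ip (x - proj b C x) (x - proj b C x) = (\<Sum>i\<in>I. (ip (x - proj b C x) (b i))\<^sup>2)"
    by (rule ip_expand(1)[OF r])
  also have "\<dots> \<le> (\<Sum>i\<in>I. d i * (ip x (b i))\<^sup>2)"
  proof (rule sum_mono)
    fix i assume i: "i \<in> I"
    then show "(ip (x - proj b C x) (b i))\<^sup>2 \<le> d i * (ip x (b i))\<^sup>2"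
      using mult_right_mono[OF d_1[of i], of "(ip x (b i))\<^sup>2"]
      by (cases "i \<in> C") (auto simp: rc d_0)
  qed
  also have "\<dots> \<le> Q x x + \<epsilon> * ip x x" using close[OF xI] by auto
  also have "Q x x = (\<Sum>i<card I. \<nu> i * (ip x (e i))\<^sup>2)"
    by (rule eigenbasis_expand[OF Q(1) e xI])
  also have "\<dots> \<le> (\<Sum>i<card I. \<epsilon> * (ip x (e i))\<^sup>2)"
  proof (rule sum_mono)
    fix i assume "i \<in> {..<card I}"
    then show "\<nu> i * (ip x (e i))\<^sup>2 \<le> \<epsilon> * (ip x (e i))\<^sup>2"
      using e0[of i] eigenvalue_small[of i] by (cases "i < card C") (auto intro: mult_right_mono)
  qed
  also have "\<dots> = \<epsilon> * ip x x" by (simp add: ip_expand(2)[OF xI] sum_distrib_left)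
  finally show ?thesis by simp
qed

text \<open>Converse direction: \<open>Q\<close> is small at \<open>y\<close>, yet the part of
  \<open>y\<close> outside the low eigenvectors has eigenvalues of at least
  \<open>1 - \<epsilon>\<close>. This bounds that part by
  \<open>2 * \<epsilon> / (1 - \<epsilon>)\<close>, and \<open>\<epsilon> \<le> 1 / 2\<close> turns
  the factor into \<open>4 * \<epsilon>\<close>.\<close>

lemma proj_close_critical:
  assumes y: "y \<in> span (b ` C)" and \<epsilon>: "\<epsilon> \<le> 1 / 2" "0 \<le> \<epsilon>"
  defines "P \<equiv> proj e {..<card C}"
  shows "ip (y - P y) (y - P y) \<le> 4 * \<epsilon> * ip y y"
proof -
  have sub: "{..<card C} \<subseteq> {..<card I}" using C_orthonormal by auto
  note oC = e_orthonormal[OF sub]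
  have yI: "y \<in> span (b ` I)" using y C_orthonormal by auto
  have PI: "P y \<in> span (b ` I)"
    using proj_in_span[of e "{..<card C}" y] span_mono[OF image_mono[OF sub], of e]
    by (auto simp: e_span P_def)
  have r: "y - P y \<in> span (b ` I)" by (intro span_diff yI PI)
  have rc: "ip (y - P y) (e i) = (if i < card C then 0 else ip y (e i))" if i: "i < card I" for i
  proof (cases "i < card C")
    case True
    then show ?thesis using proj_coord[OF _ oC] by (simp add: diff_left P_def)
  next
    case False
    then have "ip (e i) (e j) = 0" if "j \<in> {..<card C}" for j
      using orthonormalD[OF e_orthonormal[OF order_refl], of i j] that i by auto
    then have "ip (e i) (P y) = 0" unfolding P_def by (rule span_orthogonal[OF _ proj_in_span])
    then show ?thesis using False by (simp add: diff_left commute[of _ "P y"])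
  qed
  have "(1 - \<epsilon>) * ip (y - P y) (y - P y) = (\<Sum>i<card I. (1 - \<epsilon>) * (ip (y - P y) (e i))\<^sup>2)"
    by (simp add: ip_expand(2)[OF r] sum_distrib_left)
  \<comment> \<open>The additional \<epsilon> term compensates low eigenvalues that may be negative,
    down to -\<epsilon>.\<close>
  also have "\<dots> \<le> (\<Sum>i<card I. \<nu> i * (ip y (e i))\<^sup>2 + \<epsilon> * (ip y (e i))\<^sup>2)"
  proof (rule sum_mono)
    fix i assume i: "i \<in> {..<card I}"
    show "(1 - \<epsilon>) * (ip (y - P y) (e i))\<^sup>2 \<le> \<nu> i * (ip y (e i))\<^sup>2 + \<epsilon> * (ip y (e i))\<^sup>2"
    proof (cases "i < card C")
      case True
      then have "0 \<le> (\<nu> i + \<epsilon>) * (ip y (e i))\<^sup>2"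
        using eigenvalue_small[of i] by (intro mult_nonneg_nonneg) auto
      then show ?thesis using True i by (simp add: rc distrib_right)
    next
      case False
      then have "(1 - \<epsilon>) * (ip y (e i))\<^sup>2 \<le> \<nu> i * (ip y (e i))\<^sup>2"
        using eigenvalue_large[of i] i by (intro mult_right_mono) auto
      moreover have "0 \<le> \<epsilon> * (ip y (e i))\<^sup>2"
        using \<epsilon> by simp
      ultimately show ?thesis using False i by (simp add: rc)
    qed
  qed
  also have "\<dots> = Q y y + \<epsilon> * ip y y"
    by (simp add: eigenbasis_expand[OF Q(1) e yI] ip_expand(2)[OF yI] sum_distrib_left sum.distrib)
  also have "\<dots> \<le> 2 * \<epsilon> * ip y y" using close[OF yI] diagonal_sum_critical[OF y] by auto
  finally have "(1 - \<epsilon>) * ip (y - P y) (y - P y) \<le> 2 * \<epsilon> * ip y y" .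
  moreover have "1 / 2 * ip (y - P y) (y - P y) \<le> (1 - \<epsilon>) * ip (y - P y) (y - P y)"
    using \<epsilon> nonneg by (intro mult_right_mono) auto
  ultimately show ?thesis by simp
qed

text \<open>
  With \<open>P\<close> and \<open>R\<close> the two projections, \<open>P - R = (1 - R) P - R (1 - P)\<close>, and the two terms have
  orthogonal ranges; the second is the adjoint of \<open>(1 - P) R\<close>, which is small as \<open>Q\<close> is small on
  the range of \<open>R\<close> but not on the orthogonal complement of the range of \<open>P\<close>.
\<close>

theorem proj_close:
  assumes x: "x \<in> span (b ` I)" and \<epsilon>: "\<epsilon> \<le> 1 / 2" "0 \<le> \<epsilon>"
  defines "P \<equiv> proj e {..<card C}"
  shows "ip (P x - proj b C x) (P x - proj b C x) \<le> 6 * \<epsilon> * ip x x"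
proof -
  let ?R = "proj b C"
  have sub: "{..<card C} \<subseteq> {..<card I}" using C_orthonormal by auto
  note oC = e_orthonormal[OF sub]
  define z where "z = x - P x"
  define p where "p = P x - ?R (P x)"
  define w where "w = ?R z"
  have R_add: "?R (u + v) = ?R u + ?R v" for u v
    by (simp add: proj_def add_left scaleR_left_distrib sum.distrib)
  have "x = P x + z" by (simp add: z_def)
  then have "?R x = ?R (P x) + w" unfolding w_def by (metis R_add)
  then have eq: "P x - ?R x = p - w" by (simp add: p_def)
  have w: "w \<in> span (b ` C)" unfolding w_def by (rule proj_in_span)
  have "ip p w = 0" unfolding p_def by (rule proj_orthogonal[OF C_orthonormal(1,2) w])
  then have split: "ip (P x - ?R x) (P x - ?R x) = ip p p + ip w w"
    by (simp add: eq diff_left diff_right commute)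
  have pyth: "ip x x = ip (P x) (P x) + ip z z"
    unfolding P_def z_def by (rule pythagoras[OF _ oC]) simp
  have "ip p p \<le> 2 * \<epsilon> * ip (P x) (P x)"
    unfolding p_def by (rule proj_close_small) (simp add: P_def proj_in_span)
  also have "\<dots> \<le> 2 * \<epsilon> * ip x x" using pyth nonneg[of z] \<epsilon> by (intro mult_left_mono) auto
  finally have p: "ip p p \<le> 2 * \<epsilon> * ip x x" .
  have "ip (z - w) w = 0" unfolding w_def by (rule proj_orthogonal[OF C_orthonormal(1,2) proj_in_span])
  moreover have "ip z (P w) = 0"
    unfolding z_def P_def by (rule proj_orthogonal[OF _ oC proj_in_span]) simp
  ultimately have "ip w w = ip z (w - P w)" by (simp add: diff_left diff_right)
  then have "(ip w w)\<^sup>2 \<le> ip z z * ip (w - P w) (w - P w)" using Cauchy_Schwarz by metis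
  also have "\<dots> \<le> ip z z * (4 * \<epsilon> * ip w w)"
    unfolding P_def by (intro mult_left_mono proj_close_critical w \<epsilon> nonneg)
  finally have "ip w w * ip w w \<le> (4 * \<epsilon> * ip z z) * ip w w"
    by (simp add: power2_eq_square mult_ac)
  \<comment> \<open>The Cauchy-Schwarz bound contains \<open>ip w w\<close> on both sides;
    cancelling one factor leaves a linear bound. With the \<open>2 * \<epsilon>\<close> for
    \<open>p\<close> this gives the constant 6.\<close>
  then have "ip w w \<le> 4 * \<epsilon> * ip z z"
    using nonneg[of w] nonneg[of z] \<epsilon> by (cases "ip w w = 0") auto
  also have "\<dots> \<le> 4 * \<epsilon> * ip x x" using pyth nonneg[of "P x"] \<epsilon> by (intro mult_left_mono) auto
  finally show ?thesis using p split by simp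
qed

end

end

subsection \<open>Chains\<close>

lemma lookup_scaleR: "Poly_Mapping.lookup (r *\<^sub>R x) k = r *\<^sub>R Poly_Mapping.lookup x k"
proof -
  have "finite {k. r *\<^sub>R Poly_Mapping.lookup x k \<noteq> 0}"
    by (rule finite_subset[OF _ finite_keys[of x]]) (auto simp: in_keys_iff)
  then show ?thesis
    unfolding scaleR_poly_mapping_def by (simp add: Abs_poly_mapping_inverse)
qed

text \<open>The range of summation in \<open>lin_ext\<close> varies with the argument; a common
  finite superset of the supports makes additivity a termwise statement.\<close>

lemma lin_ext_superset:
  assumes "finite K" "Poly_Mapping.keys x \<subseteq> K"
  shows "lin_ext T x = (\<Sum>xs\<in>K. Poly_Mapping.lookup x xs *\<^sub>R T xs)"
  unfolding lin_ext_def using assms by (intro sum.mono_neutral_left) (auto simp: in_keys_iff)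

lemma path_inner_superset:
  assumes "finite K" "Poly_Mapping.keys x \<subseteq> K"
  shows "path_inner x y = (\<Sum>xs\<in>K. Poly_Mapping.lookup x xs * Poly_Mapping.lookup y xs)"
  unfolding path_inner_def using assms by (intro sum.mono_neutral_left) (auto simp: in_keys_iff)

lemma keys_scaleR_subset: "Poly_Mapping.keys (r *\<^sub>R x) \<subseteq> Poly_Mapping.keys x"
  by (auto simp: in_keys_iff lookup_scaleR)

lemma linear_lin_ext: "linear (lin_ext T)"
proof (rule linearI)
  fix x y :: "'a chain" and r :: real
  let ?K = "Poly_Mapping.keys x \<union> Poly_Mapping.keys y"
  have "lin_ext T (x + y) = (\<Sum>xs\<in>?K. Poly_Mapping.lookup (x + y) xs *\<^sub>R T xs)"
    by (rule lin_ext_superset) (simp_all add: Poly_Mapping.keys_add)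
  also have "\<dots> = (\<Sum>xs\<in>?K. Poly_Mapping.lookup x xs *\<^sub>R T xs)
      + (\<Sum>xs\<in>?K. Poly_Mapping.lookup y xs *\<^sub>R T xs)"
    by (simp add: lookup_add scaleR_left_distrib sum.distrib)
  also have "\<dots> = lin_ext T x + lin_ext T y"
    by (simp add: lin_ext_superset[of ?K x] lin_ext_superset[of ?K y])
  finally show "lin_ext T (x + y) = lin_ext T x + lin_ext T y" .
  have "lin_ext T (r *\<^sub>R x) = (\<Sum>xs\<in>Poly_Mapping.keys x. Poly_Mapping.lookup (r *\<^sub>R x) xs *\<^sub>R T xs)"
    by (rule lin_ext_superset) (simp_all add: keys_scaleR_subset)
  then show "lin_ext T (r *\<^sub>R x) = r *\<^sub>R lin_ext T x"
    by (simp add: lookup_scaleR lin_ext_def scaleR_sum_right)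
qed

lemma lin_ext_elem: "lin_ext T (elem xs) = T xs"
  by (simp add: lin_ext_def)

lemma path_inner_commute: "path_inner x y = path_inner y x"
  using path_inner_superset[of "Poly_Mapping.keys x \<union> Poly_Mapping.keys y" x y]
    path_inner_superset[of "Poly_Mapping.keys x \<union> Poly_Mapping.keys y" y x]
  by (simp add: mult.commute)

lemma linear_path_inner: "linear (path_inner x)"
  by (rule linearI)
    (simp_all add: path_inner_def lookup_add lookup_scaleR distrib_left sum.distrib sum_distrib_left
      mult.left_commute)

interpretation path: inner_form path_inner
proof
  show "path_inner x y = path_inner y x" for x y :: "'a chain" by (rule path_inner_commute)
  then have "(\<lambda>x. path_inner x y) = path_inner y" for y :: "'a chain" by auto
  then show "bilinear (path_inner :: 'a chain \<Rightarrow> _)"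
    by (simp add: bilinear_def linear_path_inner)
  fix x :: "'a chain"
  assume "x \<noteq> 0"
  then have "Poly_Mapping.keys x \<noteq> {}" by simp
  then show "0 < path_inner x x"
    unfolding path_inner_def by (intro sum_pos) (auto simp: in_keys_iff zero_less_mult_iff not_less)
qed

lemma path_inner_elem: "path_inner (elem xs) y = Poly_Mapping.lookup y xs"
  by (simp add: path_inner_def)

lemma elem_orthonormal: "path.orthonormal elem A"
  by (simp add: path.orthonormal_def path_inner_elem lookup_single)

lemma orth_proj_eq:
  assumes "finite I" "path.orthonormal e I"
  shows "orth_proj (span (e ` I)) x = path.proj e I x"
  unfolding orth_proj_def
  using path.proj_in_span path.proj_orthogonal[OF assms] path.proj_unique[OF assms]
  by (intro the_equality) auto

lemma sorted_eqI:
  fixes l l' :: "real list"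
  assumes "sorted l" "sorted l'" "\<And>\<mu>. count_list l \<mu> = count_list l' \<mu>"
  shows "l = l'"
proof -
  have "mset l = mset l'" by (rule multiset_eqI) (simp add: assms(3) count_mset)
  then show ?thesis using assms by (metis properties_for_sort sorted_sort_id)
qed

text \<open>Prescribing the multiplicity of every real number fixes the multiset, and sortedness
  then fixes the list, so the definite description has this value.\<close>

lemma eigenvalues_on_eq:
  assumes "sorted (map \<nu> [0..<N])"
    and "\<And>\<mu>. dim (eigenspace_on S T \<mu>) = card {i. i < N \<and> \<nu> i = \<mu>}"
  shows "eigenvalues_on S T = map \<nu> [0..<N]"
proof -
  have c: "count_list (map \<nu> [0..<N]) \<mu> = card {i. i < N \<and> \<nu> i = \<mu>}" for \<mu>
    by (auto simp: count_list_eq_length_filter length_filter_conv_card intro!: arg_cong[of _ _ card])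
  show ?thesis
    unfolding eigenvalues_on_def using assms c by (intro the_equality) (auto intro!: sorted_eqI)
qed

subsection \<open>Faces of a path\<close>

definition face :: "nat \<Rightarrow> 'v list \<Rightarrow> 'v list" where
  "face i xs = take i xs @ drop (Suc i) xs"

lemma face_split: "i < length xs \<Longrightarrow> take i xs @ xs ! i # drop (Suc i) xs = xs"
  by (rule id_take_nth_drop[symmetric])

lemma length_face: "i < length xs \<Longrightarrow> length (face i xs) = length xs - 1"
  by (simp add: face_def)

lemma path_val_face:
  assumes "i < length xs"
  shows "path_val f xs = f (xs ! i) + path_val f (face i xs)"
proof -
  have "path_val f (take i xs @ xs ! i # drop (Suc i) xs) = f (xs ! i) + path_val f (face i xs)"
    unfolding path_val_def face_def map_append list.map sum_list_append sum_list.Cons by simp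
  then show ?thesis by (simp only: face_split[OF assms])
qed

lemma subseq_face: "subseq (face i xs) xs"
proof (cases "i < length xs")
  case True
  have "subseq (take i xs @ drop (Suc i) xs) (take i xs @ [xs ! i] @ drop (Suc i) xs)"
    by (intro list_emb_append_mono list_emb_append2 subseq_order.refl)
  then show ?thesis using face_split[OF True] by (simp add: face_def)
qed (simp add: face_def)

text \<open>The Morse condition speaks of subsequences, the boundary of removed positions. If
  \<open>ys\<close> embeds into the tail, the head is the removed vertex; otherwise the heads agree
  and the tails are compared.\<close>

lemma subseq_imp_face:
  assumes "subseq ys xs" "length xs = Suc (length ys)"
  shows "\<exists>i<length xs. face i xs = ys"
  using assms
proof (induction xs arbitrary: ys rule: list.induct)
  case (Cons x xs)
  show ?case
  proof (cases "length ys = 0 \<or> subseq ys xs")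
    case True
    then have "ys = xs" using Cons.prems subseq_same_length[of ys xs] by (cases ys) simp_all
    then show ?thesis by (intro exI[of _ 0]) (simp add: face_def)
  next
    case False
    then obtain ys' where ys: "ys = x # ys'" "subseq ys' xs"
      using Cons.prems(1) by (auto elim: list_emb.cases)
    then obtain i where "i < length xs" "face i xs = ys'"
      using Cons.IH[OF ys(2)] Cons.prems(2) by auto
    then show ?thesis using ys by (intro exI[of _ "Suc i"]) (simp add: face_def)
  qed
qed simp

text \<open>With distinct vertices the removed one is recovered as a difference of sets. Hence no
  two terms of the boundary of such a path can cancel.\<close>

lemma face_inj:
  assumes "distinct xs" "i < length xs" "j < length xs" "face i xs = face j xs"
  shows "i = j"
proof -
  have "set (face k xs) = set xs - {xs ! k}" if "k < length xs" for k
  proof -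
    have "distinct (take k xs @ xs ! k # drop (Suc k) xs)"
      by (simp only: face_split[OF that] assms(1))
    moreover have "set xs = set (take k xs @ xs ! k # drop (Suc k) xs)"
      by (simp only: face_split[OF that])
    ultimately show ?thesis unfolding face_def set_append list.set distinct_append by auto
  qed
  from this[OF assms(2)] this[OF assms(3)]
  have "set xs - {xs ! i} = set xs - {xs ! j}" using assms(4) by simp
  then have "xs ! i = xs ! j" using nth_mem[OF assms(2)] by auto
  then show ?thesis using assms by (simp add: nth_eq_iff_index_eq)
qed

text \<open>Matrix entry of a boundary operator in which removing position i carries the weight
  \<open>c i\<close>. Exponential weights give the deformed boundary, the indicator of
  \<open>f = 0\<close> its limit.\<close>

definition incidence :: "(nat \<Rightarrow> real) \<Rightarrow> 'v list \<Rightarrow> 'v list \<Rightarrow> real" where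
  "incidence c ys xs =
     (if length xs \<le> 1 then 0 else \<Sum>i<length xs. (-1) ^ i * c i * (if face i xs = ys then 1 else 0))"

lemma incidence_nonzeroD:
  assumes "incidence c ys xs \<noteq> 0"
  obtains i where "i < length xs" "face i xs = ys" "c i \<noteq> 0" "1 < length xs"
proof -
  have l: "1 < length xs" using assms by (auto simp: incidence_def split: if_splits)
  have "\<not> (\<forall>i\<in>{..<length xs}. (-1) ^ i * c i * (if face i xs = ys then 1 else 0) = 0)"
  proof
    assume "\<forall>i\<in>{..<length xs}. (-1) ^ i * c i * (if face i xs = ys then 1 else 0) = 0"
    then have "incidence c ys xs = 0" unfolding incidence_def by (simp only: sum.neutral if_cancel)
    then show False using assms by contradiction
  qed
  then obtain i where "i < length xs" "(-1) ^ i * c i * (if face i xs = ys then 1 else 0) \<noteq> 0"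
    by auto
  then show ?thesis using l by (intro that[of i]) (auto split: if_splits)
qed

lemma incidence_face:
  assumes "distinct xs" "1 < length xs" "i < length xs"
  shows "incidence c (face i xs) xs = (-1) ^ i * c i"
proof -
  have "incidence c (face i xs) xs
      = (\<Sum>j<length xs. if j = i then (-1) ^ j * c j else 0)"
    unfolding incidence_def if_not_P[OF assms(2)[folded not_le]]
    using face_inj[OF assms(1) _ assms(3)] by (intro sum.cong) auto
  then show ?thesis using assms(3) by simp
qed

subsection \<open>The deformed Laplacian\<close>

lemma linear_boundary_t: "linear (boundary_t f t)"
proof -
  have "linear (exp_op f t \<circ> boundary \<circ> exp_op f (- t))"
    unfolding exp_op_def boundary_def by (intro linear_compose linear_lin_ext)
  then show ?thesis by (simp add: boundary_t_def[abs_def] o_def)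
qed

lemma boundary_t_elem:
  "boundary_t f t (elem xs) = (if length xs \<le> 1 then 0 else
     \<Sum>i<length xs. ((-1) ^ i * exp (- t * f (xs ! i))) *\<^sub>R elem (face i xs))"
proof (cases "length xs \<le> 1")
  case True
  then show ?thesis
    by (simp add: boundary_t_def exp_op_def boundary_def lin_ext_elem
        linear_0[OF linear_lin_ext] linear_cmul[OF linear_lin_ext])
next
  case False
  have "boundary_t f t (elem xs) = (\<Sum>i<length xs.
      (exp (- t * path_val f xs) * ((-1) ^ i * exp (t * path_val f (face i xs)))) *\<^sub>R elem (face i xs))"
    using False
    by (simp add: boundary_t_def exp_op_def boundary_def lin_ext_elem face_def scaleR_sum_right
        linear_sum[OF linear_lin_ext] linear_cmul[OF linear_lin_ext] mult.assoc)
  also have "\<dots> = (\<Sum>i<length xs. ((-1) ^ i * exp (- t * f (xs ! i))) *\<^sub>R elem (face i xs))"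
  proof (intro sum.cong refl)
    fix i assume "i \<in> {..<length xs}"
    then have "- t * path_val f xs + t * path_val f (face i xs) = - t * f (xs ! i)"
      by (simp add: path_val_face[of i xs f] algebra_simps)
    then have "exp (- t * path_val f xs) * exp (t * path_val f (face i xs)) = exp (- t * f (xs ! i))"
      by (metis exp_add)
    then show "(exp (- t * path_val f xs) * ((-1) ^ i * exp (t * path_val f (face i xs))))
        *\<^sub>R elem (face i xs) = ((-1) ^ i * exp (- t * f (xs ! i))) *\<^sub>R elem (face i xs)"
      by (metis mult.left_commute)
  qed
  finally show ?thesis using False by simp
qed

lemma boundary_t_incidence:
  "path_inner (boundary_t f t (elem xs)) (elem ys) = incidence (\<lambda>i. exp (- t * f (xs ! i))) ys xs"
  by (auto simp: boundary_t_elem incidence_def path.zero_left path.sum_left path.scale_left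
      path_inner_elem lookup_single intro!: sum.cong)

lemma linear_maps_span:
  assumes "linear T" "subspace V" "\<And>a. a \<in> A \<Longrightarrow> T (e a) \<in> V" "x \<in> span (e ` A)"
  shows "T x \<in> V"
  using assms(4)
proof (induction rule: span_induct_alt)
  case base
  then show ?case using assms(1,2) by (simp add: linear_0 subspace_0)
next
  case (step c x y)
  then show ?case
    using assms by (auto simp: linear_add linear_cmul subspace_add subspace_scale)
qed

lemma tendsto_exp_neg_mult:
  fixes c :: real
  assumes "0 \<le> c"
  shows "((\<lambda>t. exp (- (t * c))) \<longlongrightarrow> (if c = 0 then 1 else 0)) at_top"
proof (cases "c = 0")
  case False
  then have "filterlim (\<lambda>t. c * t) at_top at_top"
    using assms by (intro filterlim_tendsto_pos_mult_at_top[OF tendsto_const] filterlim_ident) auto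
  then have "filterlim (\<lambda>t. - (t * c)) at_bot at_top"
    by (simp add: filterlim_uminus_at_top mult.commute)
  then show ?thesis using filterlim_compose[OF exp_at_bot] False by simp
qed simp

subsection \<open>Discrete Morse functions on transitive digraphs\<close>

locale transitive_morse =
  fixes G :: "'v pair_pre_digraph" and f :: "'v \<Rightarrow> real"
  assumes digraph: "pair_digraph G" and trans: "trans (parcs G)" and morse: "discrete_morse G f"
begin

abbreviation paths :: "nat \<Rightarrow> 'v list set" where
  "paths n \<equiv> {xs. allowed G n xs}"

abbreviation P :: "nat \<Rightarrow> 'v chain set" where
  "P n \<equiv> span (elem ` paths n)"

lemma finite_paths: "finite (paths n)"
proof -
  interpret pair_digraph G by (rule digraph)
  show ?thesis
    by (rule finite_subset[OF _ finite_lists_length_eq[OF pair_finite_verts, of "n + 1"]])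
      (auto simp: allowed_def)
qed

text \<open>Transitivity extends the arcs from consecutive to arbitrary pairs of positions, a
  condition that visibly survives the removal of a vertex.\<close>

lemma allowed_iff_sorted_wrt:
  "allowed G n xs \<longleftrightarrow> length xs = n + 1 \<and> set xs \<subseteq> pverts G \<and> sorted_wrt (\<lambda>u v. (u, v) \<in> parcs G) xs"
proof -
  have "successively (\<lambda>u v. (u, v) \<in> parcs G) xs \<longleftrightarrow> sorted_wrt (\<lambda>u v. (u, v) \<in> parcs G) xs"
    by (rule successively_iff_sorted_wrt_strong) (use trans in \<open>auto dest: transD\<close>)
  then show ?thesis by (simp add: allowed_def)
qed

lemma allowed_length: "allowed G n xs \<Longrightarrow> length xs = n + 1"
  by (simp add: allowed_def)

lemma allowed_distinct:
  assumes "allowed G n xs"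
  shows "distinct xs"
proof -
  interpret pair_digraph G by (rule digraph)
  have "sorted_wrt (\<lambda>u v. (u, v) \<in> parcs G) xs"
    using assms by (simp add: allowed_iff_sorted_wrt)
  then show ?thesis by (induction xs) (use pair_no_loops in force)+
qed

lemma allowed_face:
  assumes "allowed G (Suc n) xs" "i < length xs"
  shows "allowed G n (face i xs)"
proof -
  have "set (take i xs @ xs ! i # drop (Suc i) xs) \<subseteq> pverts G"
    "sorted_wrt (\<lambda>u v. (u, v) \<in> parcs G) (take i xs @ xs ! i # drop (Suc i) xs)"
    using assms(1) by (simp_all only: face_split[OF assms(2)] allowed_iff_sorted_wrt)
  then have "set (face i xs) \<subseteq> pverts G" "sorted_wrt (\<lambda>u v. (u, v) \<in> parcs G) (face i xs)"
    unfolding face_def set_append sorted_wrt_append list.set sorted_wrt.simps by auto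
  then show ?thesis
    using assms by (simp add: allowed_iff_sorted_wrt length_face)
qed

lemma elem_in_P: "allowed G n xs \<Longrightarrow> elem xs \<in> P n"
  by (intro span_base) auto

lemma P_orthogonal:
  assumes "m \<noteq> n" "x \<in> P m" "y \<in> P n"
  shows "path_inner x y = 0"
proof (rule path.span_orthogonal[OF _ assms(3)])
  fix b assume b: "b \<in> paths n"
  have "path_inner (elem b) x = 0"
  proof (rule path.span_orthogonal[OF _ assms(2)])
    fix a assume "a \<in> paths m"
    then show "path_inner (elem b) (elem a) = 0"
      using b assms(1) allowed_length[of m a] allowed_length[of n b]
      by (auto simp: path_inner_elem lookup_single when_def)
  qed
  then show "path_inner x (elem b) = 0" by (simp add: path_inner_commute)
qed

section \<open>The chain spaces and the adjoint of the deformed boundary\<close>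

lemma Omega_eq: "Omega G n = P n"
proof -
  have "boundary x \<in> P m" if "x \<in> P (Suc m)" for x m
  proof (rule linear_maps_span[OF _ _ _ that])
    show "linear (boundary :: 'v chain \<Rightarrow> _)" unfolding boundary_def by (rule linear_lin_ext)
    fix a assume a: "a \<in> paths (Suc m)"
    then have "boundary (elem a) = (\<Sum>i<length a. (- 1) ^ i *\<^sub>R elem (face i a))"
      by (simp add: boundary_def lin_ext_elem allowed_length face_def)
    also have "\<dots> \<in> P m"
      using a by (intro span_sum span_scale elem_in_P) (auto intro: allowed_face)
    finally show "boundary (elem a) \<in> P m" .
  qed (rule subspace_span)
  then have "n = 0 \<or> boundary x \<in> P (n - 1)" if "x \<in> P n" for x
    using that by (cases n) auto
  then show ?thesis by (auto simp: Omega_def P_space_def)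
qed

lemma boundary_t_in_P: "x \<in> P (Suc n) \<Longrightarrow> boundary_t f t x \<in> P n"
proof (rule linear_maps_span[OF linear_boundary_t subspace_span])
  fix a assume "a \<in> paths (Suc n)"
  then show "boundary_t f t (elem a) \<in> P n"
    unfolding boundary_t_elem
    by (auto intro!: span_zero span_sum span_scale elem_in_P intro: allowed_face)
qed

lemma boundary_t_P_0: "x \<in> P 0 \<Longrightarrow> boundary_t f t x = 0"
  using linear_maps_span[OF linear_boundary_t[of f t] subspace_single_0, of "paths 0" elem x]
  by (auto simp: boundary_t_elem allowed_length)

text \<open>The adjoint in degree \<open>n\<close>: the coefficient at \<open>xs\<close> is what the
  adjoint equation demands for the test vector \<open>elem xs\<close>. Fixing the degree leaves a
  sum over the finite set \<open>paths (Suc n)\<close>.\<close>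

definition coboundary :: "real \<Rightarrow> nat \<Rightarrow> 'v chain \<Rightarrow> 'v chain" where
  "coboundary t n y = (\<Sum>xs\<in>paths (Suc n). path_inner (boundary_t f t (elem xs)) y *\<^sub>R elem xs)"

lemma linear_coboundary: "linear (coboundary t n)"
  unfolding coboundary_def
  by (rule linearI) (simp_all add: path.add_right path.scale_right scaleR_left_distrib sum.distrib
      scaleR_sum_right)

lemma coboundary_in_P: "coboundary t n y \<in> P (Suc n)"
  unfolding coboundary_def by (intro span_sum span_scale elem_in_P) auto

lemma lookup_coboundary:
  "Poly_Mapping.lookup (coboundary t n y) xs =
    (if allowed G (Suc n) xs then path_inner (boundary_t f t (elem xs)) y else 0)"
proof -
  have "Poly_Mapping.lookup (coboundary t n y) xs
    = (\<Sum>ys\<in>paths (Suc n). if ys = xs then path_inner (boundary_t f t (elem ys)) y else 0)"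
    unfolding coboundary_def lookup_sum lookup_scaleR
    by (intro sum.cong) (auto simp: lookup_single when_def)
  then show ?thesis using finite_paths[of "Suc n"] by simp
qed

lemma Omega_star_eq: "Omega_star G = span (elem ` (\<Union>n. paths n))"
proof
  show "Omega_star G \<subseteq> span (elem ` (\<Union>n. paths n))"
    unfolding Omega_star_def Omega_eq
    by (intro span_minimal subspace_span UN_least span_mono) auto
  show "span (elem ` (\<Union>n. paths n)) \<subseteq> Omega_star G"
    unfolding Omega_star_def Omega_eq by (rule span_mono) (auto intro: elem_in_P)
qed

lemma P_subset_Omega_star: "P n \<subseteq> Omega_star G"
  unfolding Omega_star_eq by (rule span_mono) auto

text \<open>By linearity in \<open>x\<close> it suffices to test basis paths. In degree
  \<open>Suc n\<close> the equation is the definition of \<open>coboundary\<close>; in every other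
  degree both sides vanish, since different degrees are orthogonal.\<close>

lemma boundary_t_adjoint:
  assumes "x \<in> Omega_star G" "y \<in> P n"
  shows "path_inner (boundary_t f t x) y = path_inner x (coboundary t n y)"
proof -
  define T where "T x = path_inner (boundary_t f t x) y - path_inner x (coboundary t n y)" for x
  have "linear ((\<lambda>z. path_inner z y) \<circ> boundary_t f t)"
    by (intro linear_compose linear_boundary_t bilinear_left path.bilinear)
  then have "linear T"
    unfolding T_def o_def by (rule linear_compose_sub[OF _ bilinear_left[OF path.bilinear]])
  moreover have "T (elem xs) \<in> {0}" if xs: "xs \<in> (\<Union>n. paths n)" for xs
  proof -
    obtain k where k: "allowed G k xs" using xs by auto
    show ?thesis
    proof (cases "k = Suc n")
      case False
      then have "\<not> allowed G (Suc n) xs" using k by (auto simp: allowed_def)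
      moreover have "path_inner (boundary_t f t (elem xs)) y = 0"
      proof (cases k)
        case 0
        then show ?thesis using boundary_t_P_0 elem_in_P k by (simp add: path.zero_left)
      next
        case (Suc m)
        then show ?thesis
          using False P_orthogonal[of m n] boundary_t_in_P elem_in_P k assms(2) by auto
      qed
      ultimately show ?thesis by (simp add: T_def path_inner_elem lookup_coboundary)
    qed (use k in \<open>simp add: T_def path_inner_elem lookup_coboundary\<close>)
  qed
  ultimately have "T x \<in> {0}"
    by (rule linear_maps_span[OF _ subspace_single_0 _ assms(1)[unfolded Omega_star_eq]])
  then show ?thesis by (simp add: T_def)
qed

lemma adjoint_on_eq_coboundary:
  assumes "y \<in> P n"
  shows "adjoint_on (Omega_star G) (boundary_t f t) y = coboundary t n y"
  unfolding adjoint_on_def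
proof (rule the_equality)
  have c: "coboundary t n y \<in> Omega_star G"
    using coboundary_in_P P_subset_Omega_star by blast
  then show "coboundary t n y \<in> Omega_star G \<and>
      (\<forall>x\<in>Omega_star G. path_inner (boundary_t f t x) y = path_inner x (coboundary t n y))"
    using boundary_t_adjoint assms by blast
  fix z assume z: "z \<in> Omega_star G \<and>
      (\<forall>x\<in>Omega_star G. path_inner (boundary_t f t x) y = path_inner x z)"
  then have d: "z - coboundary t n y \<in> Omega_star G"
    using c unfolding Omega_star_def by (simp add: span_diff)
  then have "path_inner (z - coboundary t n y) z = path_inner (z - coboundary t n y) (coboundary t n y)"
    using z boundary_t_adjoint[OF d assms] by metis
  then have "path_inner (z - coboundary t n y) (z - coboundary t n y) = 0"
    by (simp add: path.diff_right)
  then show "z = coboundary t n y" by (simp add: path.eq_zero_iff)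
qed

section \<open>The Laplacian as a bilinear form\<close>

text \<open>The form represented by the Laplacian on degree \<open>n\<close>. Unlike the operator,
  which contains a definite description, it is evidently bilinear and symmetric on all chains, as
  the spectral theorem above requires.\<close>

definition energy :: "nat \<Rightarrow> real \<Rightarrow> 'v chain \<Rightarrow> 'v chain \<Rightarrow> real" where
  "energy n t x y = path_inner (coboundary t n x) (coboundary t n y)
     + path_inner (boundary_t f t x) (boundary_t f t y)"

lemma bilinear_energy: "bilinear (energy n t)"
  unfolding bilinear_def energy_def
  by (auto intro!: linearI simp: linear_add[OF linear_coboundary] linear_add[OF linear_boundary_t]
      linear_cmul[OF linear_coboundary] linear_cmul[OF linear_boundary_t]
      path.add_left path.add_right path.scale_left path.scale_right algebra_simps)

lemma energy_commute: "energy n t x y = energy n t y x"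
  unfolding energy_def using path_inner_commute by metis

lemma Laplacian_t_weak:
  assumes "x \<in> P n"
  shows "Laplacian_t G f t x \<in> P n"
    and "y \<in> P n \<Longrightarrow> path_inner (Laplacian_t G f t x) y = energy n t x y"
proof -
  \<comment> \<open>For \<open>n = 0\<close> the index \<open>n - 1\<close> is again 0; the boundary
    of \<open>x\<close> is then 0, which lies in every \<open>P k\<close>, so the adjoint formula
    still applies.\<close>
  let ?c = "coboundary t (n - 1) (boundary_t f t x)"
  have bx: "boundary_t f t x \<in> P (n - 1)"
    using boundary_t_in_P boundary_t_P_0 assms by (cases n) (auto simp: span_zero)
  have L: "Laplacian_t G f t x = boundary_t f t (coboundary t n x) + ?c"
    unfolding Laplacian_t_def adjoint_on_eq_coboundary[OF assms] adjoint_on_eq_coboundary[OF bx] ..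
  have "?c \<in> P n"
  proof (cases n)
    case 0
    then show ?thesis
      using boundary_t_P_0 assms by (simp add: linear_0[OF linear_coboundary] span_zero)
  next
    case (Suc m)
    then show ?thesis using coboundary_in_P[of t m] by simp
  qed
  then show "Laplacian_t G f t x \<in> P n"
    unfolding L by (intro span_add boundary_t_in_P coboundary_in_P)
  assume y: "y \<in> P n"
  have star: "y \<in> Omega_star G" "coboundary t n x \<in> Omega_star G"
    using y coboundary_in_P P_subset_Omega_star by blast+
  have "path_inner (Laplacian_t G f t x) y
      = path_inner (boundary_t f t (coboundary t n x)) y + path_inner y ?c"
    unfolding L path.add_left path_inner_commute[of ?c y] ..
  also have "\<dots> = path_inner (coboundary t n x) (coboundary t n y)
      + path_inner (boundary_t f t y) (boundary_t f t x)"
    using boundary_t_adjoint[OF star(2) y] boundary_t_adjoint[OF star(1) bx] by simp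
  finally show "path_inner (Laplacian_t G f t x) y = energy n t x y"
    by (simp add: energy_def path_inner_commute[of "boundary_t f t y" "boundary_t f t x"])
qed

text \<open>The residual of the eigenvector equation stays in \<open>P n\<close>, so the weak
  equation can be tested against the residual itself.\<close>

lemma eigenspace_on_eq:
  "eigenspace_on (Omega G n) (Laplacian_t G f t) \<mu>
    = {x \<in> P n. \<forall>y\<in>P n. energy n t x y = \<mu> * path_inner x y}"
proof -
  have "Laplacian_t G f t x = \<mu> *\<^sub>R x \<longleftrightarrow> (\<forall>y\<in>P n. energy n t x y = \<mu> * path_inner x y)"
    if x: "x \<in> P n" for x
  proof
    assume "Laplacian_t G f t x = \<mu> *\<^sub>R x"
    then show "\<forall>y\<in>P n. energy n t x y = \<mu> * path_inner x y"
      using Laplacian_t_weak(2)[OF x, of _ t] by (metis path.scale_left real_scaleR_def)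
  next
    let ?d = "Laplacian_t G f t x - \<mu> *\<^sub>R x"
    assume *: "\<forall>y\<in>P n. energy n t x y = \<mu> * path_inner x y"
    have d: "?d \<in> P n" by (intro span_diff span_scale x Laplacian_t_weak)
    have "path_inner ?d ?d = path_inner (Laplacian_t G f t x) ?d - \<mu> * path_inner x ?d"
      by (simp add: path.diff_left path.scale_left)
    also have "\<dots> = 0" using Laplacian_t_weak(2)[OF x d] * d by simp
    finally show "Laplacian_t G f t x = \<mu> *\<^sub>R x" by (simp add: path.eq_zero_iff)
  qed
  then show ?thesis by (auto simp: eigenspace_on_def Omega_eq)
qed

text \<open>Both norms are expanded over basis paths. For \<open>n = 0\<close> truncated subtraction
  lets the second sum run over \<open>paths 0\<close>, but its terms vanish because
  \<open>incidence\<close> is 0 on single vertices.\<close>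

lemma energy_elem:
  assumes "a \<in> paths n" "b \<in> paths n"
  shows "energy n t (elem a) (elem b) =
    (\<Sum>c\<in>paths (Suc n). incidence (\<lambda>i. exp (- (t * f (c ! i)))) a c * incidence (\<lambda>i. exp (- (t * f (c ! i)))) b c)
    + (\<Sum>c\<in>paths (n - 1). incidence (\<lambda>i. exp (- (t * f (a ! i)))) c a * incidence (\<lambda>i. exp (- (t * f (b ! i)))) c b)"
proof -
  have c: "path_inner (coboundary t n (elem x)) (elem c) = incidence (\<lambda>i. exp (- (t * f (c ! i)))) x c"
    if "c \<in> paths (Suc n)" for c x
  proof -
    have "path_inner (coboundary t n (elem x)) (elem c) = path_inner (boundary_t f t (elem c)) (elem x)"
      using that lookup_coboundary[of t n "elem x" c]
      by (subst path_inner_commute) (simp add: path_inner_elem)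
    then show ?thesis using boundary_t_incidence[of f t c x] by simp
  qed
  have b: "path_inner (boundary_t f t (elem x)) (elem c) = incidence (\<lambda>i. exp (- (t * f (x ! i)))) c x" for x c
    using boundary_t_incidence[of f t x c] by simp
  have P: "boundary_t f t (elem a) \<in> P (n - 1)"
    using boundary_t_in_P boundary_t_P_0 elem_in_P assms by (cases n) (auto simp: span_zero)
  have "path_inner (coboundary t n (elem a)) (coboundary t n (elem b)) =
    (\<Sum>c\<in>paths (Suc n). incidence (\<lambda>i. exp (- (t * f (c ! i)))) a c * incidence (\<lambda>i. exp (- (t * f (c ! i)))) b c)"
    unfolding path.parseval[OF finite_paths elem_orthonormal coboundary_in_P, of t n "elem a" "coboundary t n (elem b)"]
    by (intro sum.cong refl arg_cong2[of _ _ _ _ "(*)"] c)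
  moreover have "path_inner (boundary_t f t (elem a)) (boundary_t f t (elem b)) =
    (\<Sum>c\<in>paths (n - 1). incidence (\<lambda>i. exp (- (t * f (a ! i)))) c a * incidence (\<lambda>i. exp (- (t * f (b ! i)))) c b)"
    unfolding path.parseval[OF finite_paths elem_orthonormal P, of "boundary_t f t (elem b)"] b ..
  ultimately show ?thesis unfolding energy_def by (rule arg_cong2)
qed

section \<open>The limit form and the Morse condition\<close>

definition incidence_lim :: "'v list \<Rightarrow> 'v list \<Rightarrow> real" where
  "incidence_lim ys xs = incidence (\<lambda>i. if f (xs ! i) = 0 then 1 else 0) ys xs"

text \<open>Nonnegativity of \<open>f\<close> on the vertices excludes growing exponentials, so
  every entry has a finite limit.\<close>

lemma incidence_tendsto:
  assumes "allowed G n xs"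
  shows "((\<lambda>t. incidence (\<lambda>i. exp (- (t * f (xs ! i)))) ys xs) \<longlongrightarrow> incidence_lim ys xs) at_top"
proof -
  have "0 \<le> f (xs ! i)" if "i < length xs" for i
    using assms nth_mem[OF that] morse by (auto simp: allowed_def discrete_morse_def)
  then show ?thesis
    unfolding incidence_lim_def incidence_def
    by (auto intro!: tendsto_sum tendsto_mult tendsto_exp_neg_mult tendsto_const)
qed

text \<open>Removing a vertex lowers the value of a path by \<open>f\<close> at that vertex, so
  equal values mean that \<open>f\<close> is 0 there. As the removed position is unique, the entry
  is a single sign, whose square is 1.\<close>

lemma incidence_lim_cases:
  assumes c: "allowed G (Suc m) c"
  shows "incidence_lim a c \<noteq> 0 \<longleftrightarrow> length a = m + 1 \<and> strict_subseq a c \<and> path_val f a = path_val f c"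
    and "incidence_lim a c \<noteq> 0 \<Longrightarrow> incidence_lim a c * incidence_lim a c = 1"
proof -
  have l: "length c = m + 2" using allowed_length[OF c] by simp
  have A: "incidence_lim a c \<noteq> 0 \<and> incidence_lim a c * incidence_lim a c = 1"
    if a: "length a = m + 1" "strict_subseq a c" "path_val f a = path_val f c"
  proof -
    obtain i where i: "i < length c" "face i c = a"
      using subseq_imp_face[of a c] a(1,2) l unfolding strict_subseq_def by auto
    then have "f (c ! i) = 0" using path_val_face[of i c f] that by simp
    then have "incidence_lim a c = (-1) ^ i"
      using incidence_face[OF allowed_distinct[OF c], of i] i l by (auto simp: incidence_lim_def)
    then show ?thesis by (simp flip: power_mult_distrib)
  qed
  have B: "length a = m + 1 \<and> strict_subseq a c \<and> path_val f a = path_val f c"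
    if nz: "incidence_lim a c \<noteq> 0"
  proof -
    obtain i where i: "i < length c" "face i c = a" "f (c ! i) = 0"
      using incidence_nonzeroD[OF nz[unfolded incidence_lim_def]] by (metis (full_types))
    then have "length a = m + 1" using length_face[of i c] l by simp
    then show ?thesis
      using i l path_val_face[of i c f] subseq_face[of i c] by (auto simp: strict_subseq_def)
  qed
  show "incidence_lim a c \<noteq> 0 \<longleftrightarrow> length a = m + 1 \<and> strict_subseq a c \<and> path_val f a = path_val f c"
    using A B by blast
  show "incidence_lim a c \<noteq> 0 \<Longrightarrow> incidence_lim a c * incidence_lim a c = 1"
    using A B by blast
qed

lemma incidence_lim_iff_down:
  assumes "allowed G m a" "allowed G (Suc m) c"
  shows "incidence_lim a c \<noteq> 0 \<longleftrightarrow> a \<in> down_paths G f (Suc m) c"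
  unfolding incidence_lim_cases(1)[OF assms(2), of a] down_paths_def
  using assms(1) allowed_length[OF assms(1)] by simp

lemma incidence_lim_iff_up:
  assumes "allowed G m a" "allowed G (Suc m) c"
  shows "incidence_lim a c \<noteq> 0 \<longleftrightarrow> c \<in> up_paths G f m a"
  unfolding incidence_lim_cases(1)[OF assms(2), of a] up_paths_def
  using assms(2) allowed_length[OF assms(1)] by auto

text \<open>An infinite set has \<open>card\<close> 0, so only finiteness turns the cardinality
  conditions into uniqueness and emptiness.\<close>

lemma finite_up_down: "finite (up_paths G f n xs)" "finite (down_paths G f n xs)"
proof -
  have "up_paths G f n xs \<subseteq> paths (n + 1)" "down_paths G f n xs \<subseteq> paths (n - 1)"
    by (auto simp: up_paths_def down_paths_def)
  then show "finite (up_paths G f n xs)" "finite (down_paths G f n xs)"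
    using finite_subset finite_paths by blast+
qed

lemma up_down_unique:
  assumes "allowed G n xs"
  shows "a \<in> up_paths G f n xs \<Longrightarrow> b \<in> up_paths G f n xs \<Longrightarrow> a = b"
    and "a \<in> down_paths G f n xs \<Longrightarrow> b \<in> down_paths G f n xs \<Longrightarrow> a = b"
proof -
  have "card (up_paths G f n xs) \<le> Suc 0" "card (down_paths G f n xs) \<le> Suc 0"
    using morse assms unfolding discrete_morse_def by auto
  then show "a \<in> up_paths G f n xs \<Longrightarrow> b \<in> up_paths G f n xs \<Longrightarrow> a = b"
    "a \<in> down_paths G f n xs \<Longrightarrow> b \<in> down_paths G f n xs \<Longrightarrow> a = b"
    by (simp_all add: card_le_Suc0_iff_eq finite_up_down)
qed

definition energy_lim :: "nat \<Rightarrow> 'v list \<Rightarrow> 'v list \<Rightarrow> real" where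
  "energy_lim n a b = (\<Sum>c\<in>paths (Suc n). incidence_lim a c * incidence_lim b c)
    + (\<Sum>c\<in>paths (n - 1). incidence_lim c a * incidence_lim c b)"

lemma energy_tendsto:
  assumes "a \<in> paths n" "b \<in> paths n"
  shows "((\<lambda>t. energy n t (elem a) (elem b)) \<longlongrightarrow> energy_lim n a b) at_top"
proof -
  have "((\<lambda>t. incidence (\<lambda>i. exp (- (t * f (c ! i)))) x c) \<longlongrightarrow> incidence_lim x c) at_top"
    if "c \<in> paths m" for x c m
    using that by (intro incidence_tendsto) simp
  then show ?thesis
    unfolding energy_elem[OF assms] energy_lim_def using assms
    by (intro tendsto_add tendsto_sum tendsto_mult)
qed

lemma incidence_lim_0: "allowed G 0 xs \<Longrightarrow> incidence_lim ys xs = 0"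
  using allowed_length[of 0 xs] by (simp add: incidence_lim_def incidence_def)

text \<open>A nonzero term of the first sum would give \<open>c\<close> two faces with its value of
  \<open>f\<close>, a nonzero term of the second would give \<open>c\<close> two such cofaces.
  Either contradicts the Morse condition at \<open>c\<close>.\<close>

lemma energy_lim_off_diagonal:
  assumes "a \<in> paths n" "b \<in> paths n" "a \<noteq> b"
  shows "energy_lim n a b = 0"
proof -
  have "incidence_lim a c = 0 \<or> incidence_lim b c = 0" if "c \<in> paths (Suc n)" for c
    using that assms incidence_lim_iff_down[of n a c] incidence_lim_iff_down[of n b c]
      up_down_unique(2)[of "Suc n" c a b] by auto
  moreover have "incidence_lim c a = 0 \<or> incidence_lim c b = 0" if c: "c \<in> paths (n - 1)" for c
  proof (cases n)
    case 0
    then show ?thesis using assms incidence_lim_0 by simp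
  next
    case (Suc m)
    then show ?thesis
      using c assms incidence_lim_iff_up[of m c a] incidence_lim_iff_up[of m c b]
        up_down_unique(1)[of m c a b] by auto
  qed
  ultimately have "\<forall>c\<in>paths (Suc n). incidence_lim a c * incidence_lim b c = 0"
    "\<forall>c\<in>paths (n - 1). incidence_lim c a * incidence_lim c b = 0" by auto
  then show ?thesis unfolding energy_lim_def by (simp only: sum.neutral add_0)
qed

lemma energy_lim_critical:
  assumes "critical G f n a"
  shows "energy_lim n a a = 0"
proof -
  have a: "a \<in> paths n" and emp: "up_paths G f n a = {}" "down_paths G f n a = {}"
    using assms finite_up_down by (auto simp: critical_def)
  have "incidence_lim a c = 0" if "c \<in> paths (Suc n)" for c
    using that a incidence_lim_iff_up[of n a c] emp by auto
  moreover have "incidence_lim c a = 0" if c: "c \<in> paths (n - 1)" for c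
  proof (cases n)
    case 0
    then show ?thesis using a incidence_lim_0 by simp
  next
    case (Suc m)
    then show ?thesis using c a incidence_lim_iff_down[of m c a] emp by auto
  qed
  ultimately show ?thesis unfolding energy_lim_def by simp
qed

text \<open>A coface or face with the same value of \<open>f\<close> contributes a square equal to
  1; all other summands are squares too.\<close>

lemma energy_lim_noncritical:
  assumes "a \<in> paths n" "\<not> critical G f n a"
  shows "1 \<le> energy_lim n a a"
proof -
  have nn: "0 \<le> (\<Sum>c\<in>S. incidence_lim (g c) (h c) * incidence_lim (g c) (h c))" for S g h
    by (intro sum_nonneg) simp
  consider c where "c \<in> up_paths G f n a" | c where "c \<in> down_paths G f n a"
    using assms finite_up_down by (auto simp: critical_def card_gt_0_iff)
  then show ?thesis
  proof cases
    case (1 c)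
    then have c: "c \<in> paths (Suc n)" by (simp add: up_paths_def)
    then have "incidence_lim a c * incidence_lim a c = 1"
      using 1 assms incidence_lim_iff_up[of n a c] incidence_lim_cases(2)[of n c a] by auto
    then have "1 \<le> (\<Sum>c\<in>paths (Suc n). incidence_lim a c * incidence_lim a c)"
      using member_le_sum[OF c _ finite_paths, of "\<lambda>c. incidence_lim a c * incidence_lim a c"] by simp
    then show ?thesis using nn[of "\<lambda>c. c" "\<lambda>c. a"] by (simp add: energy_lim_def add_increasing2)
  next
    case (2 c)
    then have n: "0 < n" and c: "c \<in> paths (n - 1)" by (auto simp: down_paths_def)
    then have "incidence_lim c a * incidence_lim c a = 1"
      using 2 assms incidence_lim_iff_down[of "n - 1" c a] incidence_lim_cases(2)[of "n - 1" a c] by auto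
    then have "1 \<le> (\<Sum>c\<in>paths (n - 1). incidence_lim c a * incidence_lim c a)"
      using member_le_sum[OF c _ finite_paths, of "\<lambda>c. incidence_lim c a * incidence_lim c a"] by simp
    then show ?thesis using nn[of "\<lambda>c. a" "\<lambda>c. c"] by (simp add: energy_lim_def add_increasing)
  qed
qed

section \<open>Convergence of the small spectral subspaces\<close>

lemma critical_paths: "{xs. critical G f n xs} \<subseteq> paths n"
  by (auto simp: critical_def)

theorem W_space_tendsto_Crit: "subspaces_tendsto (Omega G n) (W_space G f n) (Crit G f n) at_top"
proof -
  let ?C = "{xs. critical G f n xs}" and ?N = "card (paths n)"
  let ?c = "card ?C"
  note on = finite_paths[of n] elem_orthonormal[of "paths n"]
  have C: "finite ?C" "?c \<le> ?N"
    by (rule finite_subset[OF critical_paths finite_paths], rule card_mono[OF finite_paths critical_paths])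
  have "\<forall>t. \<exists>e \<nu>. path.eigenbasis (energy n t) (P n) ?N e \<nu>"
  proof
    fix t
    obtain e \<nu> where "path.eigenbasis (energy n t) (P n) ?N e \<nu>"
      by (rule path.spectral_theorem[OF bilinear_energy energy_commute on])
    then show "\<exists>e \<nu>. path.eigenbasis (energy n t) (P n) ?N e \<nu>" by (intro exI)
  qed
  then have "\<exists>e \<nu>. \<forall>t. path.eigenbasis (energy n t) (P n) ?N (e t) (\<nu> t)"
    by (simp only: choice_iff)
  then obtain e \<nu> where "\<forall>t. path.eigenbasis (energy n t) (P n) ?N (e t) (\<nu> t)"
    by (elim exE)
  then have e: "path.eigenbasis (energy n t) (P n) ?N (e t) (\<nu> t)" for t ..
  have e_on: "path.orthonormal (e t) {..<?N}" for t
    using e by (auto simp: path.eigenbasis_def)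
  define d where "d a = energy_lim n a a" for a
  have d: "\<And>a. a \<in> ?C \<Longrightarrow> d a = 0" "\<And>a. a \<in> paths n - ?C \<Longrightarrow> 1 \<le> d a"
    using energy_lim_critical energy_lim_noncritical by (auto simp: d_def)
  define \<epsilon> where "\<epsilon> t = (\<Sum>a\<in>paths n. \<Sum>b\<in>paths n.
    \<bar>energy n t (elem a) (elem b) - (if a = b then d a else 0)\<bar>)" for t
  have \<epsilon>_nonneg: "0 \<le> \<epsilon> t" for t
    unfolding \<epsilon>_def by (intro sum_nonneg) auto
  have "(\<epsilon> \<longlongrightarrow> (\<Sum>a\<in>paths n. \<Sum>b\<in>paths n. \<bar>energy_lim n a b - (if a = b then d a else 0)\<bar>)) at_top"
    unfolding \<epsilon>_def by (intro tendsto_intros energy_tendsto)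
  also have "(\<Sum>a\<in>paths n. \<Sum>b\<in>paths n. \<bar>energy_lim n a b - (if a = b then d a else 0)\<bar>) = 0"
    using energy_lim_off_diagonal by (intro sum.neutral ballI) (auto simp: d_def)
  finally have \<epsilon>_0: "(\<epsilon> \<longlongrightarrow> 0) at_top" .
  have close: "\<bar>energy n t x x - (\<Sum>a\<in>paths n. d a * (path_inner x (elem a))\<^sup>2)\<bar> \<le> \<epsilon> t * path_inner x x"
    if "x \<in> P n" for t x
    unfolding \<epsilon>_def by (rule path.quadratic_form_close[OF bilinear_energy on that])
  note pert = bilinear_energy energy_commute on critical_paths d e close
  have small: "\<bar>\<nu> t k\<bar> \<le> \<epsilon> t" if "k < ?c" for t k
    by (rule path.eigenvalue_small[OF pert]; (assumption | rule that))
  have large: "1 - \<epsilon> t \<le> \<nu> t k" if "?c \<le> k" "k < ?N" for t k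
    by (rule path.eigenvalue_large[OF pert]; (assumption | rule that))
  have eigenspace: "eigenspace_on (Omega G n) (Laplacian_t G f t) \<mu> = span (e t ` {i. i < ?N \<and> \<nu> t i = \<mu>})"
    for t \<mu>
    unfolding eigenspace_on_eq by (rule path.eigenspace_eq_span[OF bilinear_energy energy_commute e])
  have "eigenvalues_on (Omega G n) (Laplacian_t G f t) = map (\<nu> t) [0..<?N]" for t
  proof (rule eigenvalues_on_eq)
    show "sorted (map (\<nu> t) [0..<?N])"
      using e[of t] by (auto simp: path.eigenbasis_def sorted_iff_nth_mono)
    show "dim (eigenspace_on (Omega G n) (Laplacian_t G f t) \<mu>) = card {i. i < ?N \<and> \<nu> t i = \<mu>}" for \<mu>
      unfolding eigenspace
      by (rule path.dim_orthonormal[OF path.orthonormal_subset[OF e_on]]) auto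
  qed
  then have ev: "eigenvalue_t G f n k = (\<lambda>t. \<nu> t k)" if "k < ?N" for k
    using that by (simp add: eigenvalue_t_def[abs_def])
  have dim: "dim (Omega G n) = ?N"
    unfolding Omega_eq by (rule path.dim_orthonormal[OF on(2)])
  have tends: "(eigenvalue_t G f n k \<longlongrightarrow> 0) at_top \<longleftrightarrow> k < ?c" if k: "k < ?N" for k
  proof
    assume "(eigenvalue_t G f n k \<longlongrightarrow> 0) at_top"
    \<comment> \<open>For an index beyond the number of critical paths this sum is at least 1 for
      all \<open>t\<close>, so it cannot tend to 0.\<close>
    then have "((\<lambda>t. \<nu> t k + \<epsilon> t) \<longlongrightarrow> 0 + 0) at_top"
      unfolding ev[OF k] by (intro tendsto_add \<epsilon>_0)
    then have "eventually (\<lambda>t. \<nu> t k + \<epsilon> t < 1) at_top"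
      by (rule order_tendstoD) simp
    then obtain t where "\<nu> t k + \<epsilon> t < 1"
      using eventually_happens trivial_limit_at_top_linorder by blast
    then show "k < ?c" using large[of k t] k by (cases "k < ?c") auto
  next
    assume "k < ?c"
    then have "((\<lambda>t. \<nu> t k) \<longlongrightarrow> 0) at_top"
      using small by (intro Lim_null_comparison[OF _ \<epsilon>_0]) auto
    then show "(eigenvalue_t G f n k \<longlongrightarrow> 0) at_top" by (simp only: ev[OF k])
  qed
  \<comment> \<open>The eigenspace of \<open>\<nu> t k\<close> gathers every index with the same
    eigenvalue, possibly also a large one. For \<open>\<epsilon> t < 1 / 2\<close> the bounds
    \<open>\<epsilon> t\<close> and \<open>1 - \<epsilon> t\<close> exclude such a
    coincidence.\<close>
  have W: "W_space G f n t = span (e t ` {..<?c})" if t: "\<epsilon> t < 1 / 2" for t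
  proof
    have K: "{k. k < dim (Omega G n) \<and> (eigenvalue_t G f n k \<longlongrightarrow> 0) at_top} = {..<?c}"
      using tends C by (auto simp: dim)
    have W': "W_space G f n t = span (\<Union>k<?c. span (e t ` {i. i < ?N \<and> \<nu> t i = \<nu> t k}))"
      unfolding W_space_def K using ev C by (simp add: eigenspace)
    have "i < ?c" if "i < ?N" "\<nu> t i = \<nu> t k" "k < ?c" for i k
      using small[of k t] large[of i t] that t by (cases "i < ?c") auto
    then show "W_space G f n t \<subseteq> span (e t ` {..<?c})"
      unfolding W' by (intro span_minimal subspace_span UN_least span_mono) auto
    have "e t k \<in> span (e t ` {i. i < ?N \<and> \<nu> t i = \<nu> t k})" if "k < ?c" for k
      using that C by (intro span_base) auto
    then show "span (e t ` {..<?c}) \<subseteq> W_space G f n t"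
      unfolding W' by (intro span_mono) auto
  qed
  show ?thesis
    unfolding subspaces_tendsto_def
  proof (intro allI impI)
    fix r :: real assume r: "0 < r"
    \<comment> \<open>The bound 1/2 serves the description of \<open>W_space\<close> and
      \<open>proj_close\<close>; the bound \<open>r\<^sup>2 / 6\<close> makes the squared distance
      at most \<open>r\<^sup>2\<close> times the squared norm.\<close>
    have "eventually (\<lambda>t. \<epsilon> t < min (1 / 2) (r\<^sup>2 / 6)) at_top"
      using r by (intro order_tendstoD[OF \<epsilon>_0]) auto
    then show "\<forall>\<^sub>F t in at_top. \<forall>x\<in>Omega G n.
      path_norm (orth_proj (W_space G f n t) x - orth_proj (Crit G f n) x) \<le> r * path_norm x"
    proof (rule eventually_mono, intro ballI)
      fix t x assume t: "\<epsilon> t < min (1 / 2) (r\<^sup>2 / 6)" and "x \<in> Omega G n"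
      then have x: "x \<in> P n" by (simp add: Omega_eq)
      have sub: "{..<?c} \<subseteq> {..<?N}" using C by auto
      have "orth_proj (W_space G f n t) x = path.proj (e t) {..<?c} x"
        using t orth_proj_eq[OF _ path.orthonormal_subset[OF e_on sub]] by (simp add: W)
      moreover have "orth_proj (Crit G f n) x = path.proj elem ?C x"
        unfolding Crit_def by (rule orth_proj_eq[OF C(1) elem_orthonormal])
      ultimately have proj: "orth_proj (W_space G f n t) x = path.proj (e t) {..<?c} x"
        "orth_proj (Crit G f n) x = path.proj elem ?C x" .
      let ?d = "path.proj (e t) {..<?c} x - path.proj elem ?C x"
      have "\<epsilon> t \<le> 1 / 2" using t by simp
      then have "path_inner ?d ?d \<le> 6 * \<epsilon> t * path_inner x x"
        by - (rule path.proj_close[OF pert]; (assumption | rule x \<epsilon>_nonneg))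
      also have "\<dots> \<le> r\<^sup>2 * path_inner x x"
        using t by (intro mult_right_mono path.nonneg) auto
      finally have "sqrt (path_inner ?d ?d) \<le> sqrt (r\<^sup>2 * path_inner x x)" by simp
      then show "path_norm (orth_proj (W_space G f n t) x - orth_proj (Crit G f n) x) \<le> r * path_norm x"
        unfolding proj path_norm_def using r by (simp add: real_sqrt_mult)
    qed
  qed
qed

end

theorem theorem3p2:
  fixes G :: "'v pair_pre_digraph" and f :: "'v \<Rightarrow> real" and n :: nat
  assumes "pair_digraph G" and "parcs G \<noteq> {}"
    and "trans (parcs G)"
    and "discrete_morse G f"
  shows "subspaces_tendsto (Omega G n) (W_space G f n) (Crit G f n) at_top"
proof -
  interpret transitive_morse G f
    using assms by (intro transitive_morse.intro)
  show ?thesis by (rule W_space_tendsto_Crit)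
qed

end
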